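(* Let $X$ be a finite partially ordered set, let $k$ be a field, and let $\Phi_X$ be the matrix, with respect to the basis of simple modules, of the Coxeter transformation of the incidence algebra $kX$. Then for all $x,y\in X$, $$(\Phi_X)_{xy}=-\sum_{z\in X\,:\,z\geq x}\mu_X(y,z),$$ where $\mu_X$ is the Möbius function of $X$.
   Context: The incidence algebra $kX$ is the $k$-algebra spanned by elements $e_{xy}$ for the pairs $x\leq y$ in $X$, with multiplication $e_{xy}e_{zw}=\delta_{yz}e_{xw}$. It is finite dimensional of finite global dimension. Modules are finite dimensional right $kX$-modules; the simple modules $S_x$ are indexed by $x\in X$ ($S_x$ is one-dimensional, with $e_{xx}$ acting as the identity and the other $e_{yz}$ acting as zero), and their classes form a basis of the Grothendieck group $K_0$. The Euler form is the bilinear form on $K_0$ induced by $\langle M,N\rangle_X=\sum_{i}(-1)^i\dim_k\operatorname{Ext}^i_{kX}(M,N)$; it is non-degenerate. $C_X$ denotes the $X\times X$ matrix of the Euler form with respect to the basis of simples, $(C_X)_{xy}=\langle S_x,S_y\rangle_X$. The Coxeter transformation $\Phi$ is defined by $\langle u,v\rangle_X=-\langle v,\Phi u\rangle_X$ for all $u,v\in K_0$; $\Phi_X$ denotes its matrix with respect to the basis of simples (acting on column vectors), so $\Phi_X=-C_X^{-1}C_X^t$. The incidence matrix $\mathbf{1}_X$ is the $X\times X$ matrix with $(\mathbf{1}_X)_{xy}=1$ if $x\leq y$ and $0$ otherwise; it is invertible over $\mathbb{Z}$. The Möbius function $\mu_X:X\times X\to\mathbb{Z}$ is defined by $\mu_X(x,y)=(\mathbf{1}_X^{-1})_{xy}$.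 *)

theory Defs
  imports "HOL-Analysis.Determinants" "HOL-Library.Function_Algebras" "HOL-Library.Poly_Mapping"
begin

section \<open>The incidence algebra\<close>

text \<open>
  An element is given by its coefficients: \<open>a\<close> stands for the sum of the
  \<open>a x y\<close> times the basis element \<open>incalg_unit x y\<close>, over \<open>x \<le> y\<close>.
\<close>

typedef (overloaded) ('x::order, 'k::zero) incalg =
  "{a :: 'x \<Rightarrow> 'x \<Rightarrow> 'k. \<forall>x y. a x y \<noteq> 0 \<longrightarrow> x \<le> y}"
  morphisms coeff Abs_incalg
  by (rule exI[of _ "\<lambda>_ _. 0"]) simp

setup_lifting type_definition_incalg

lift_definition incalg_unit :: "'x::order \<Rightarrow> 'x \<Rightarrow> ('x, 'k::field) incalg" is
  "\<lambda>x y u v. if x \<le> y \<and> u = x \<and> v = y then 1 else 0"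
  by (auto split: if_splits)

lift_definition incalg_scale :: "'k::field \<Rightarrow> ('x::order, 'k) incalg \<Rightarrow> ('x, 'k) incalg" is
  "\<lambda>c a x y. c * a x y"
  by auto

instantiation incalg :: ("{finite,order}", field) ring_1
begin

lift_definition zero_incalg :: "('a, 'b) incalg" is "\<lambda>_ _. 0" by simp
lift_definition one_incalg :: "('a, 'b) incalg" is "\<lambda>x y. if x = y then 1 else 0"
  by (auto split: if_splits)
lift_definition plus_incalg :: "('a, 'b) incalg \<Rightarrow> ('a, 'b) incalg \<Rightarrow> ('a, 'b) incalg" is
  "\<lambda>a b x y. a x y + b x y"
  subgoal for a b x y by (cases "a x y = 0") auto
  done
lift_definition uminus_incalg :: "('a, 'b) incalg \<Rightarrow> ('a, 'b) incalg" is
  "\<lambda>a x y. - a x y" by simp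
lift_definition minus_incalg :: "('a, 'b) incalg \<Rightarrow> ('a, 'b) incalg \<Rightarrow> ('a, 'b) incalg" is
  "\<lambda>a b x y. a x y - b x y"
  subgoal for a b x y by (cases "a x y = 0") auto
  done
lift_definition times_incalg :: "('a, 'b) incalg \<Rightarrow> ('a, 'b) incalg \<Rightarrow> ('a, 'b) incalg" is
  "\<lambda>a b x y. \<Sum>z\<in>UNIV. a x z * b z y"
proof -
  fix a b :: "'a \<Rightarrow> 'a \<Rightarrow> 'b" and x y
  assume a: "\<And>x y. a x y \<noteq> 0 \<Longrightarrow> x \<le> y" and b: "\<And>x y. b x y \<noteq> 0 \<Longrightarrow> x \<le> y"
  assume "(\<Sum>z\<in>UNIV. a x z * b z y) \<noteq> 0"
  then obtain z where "a x z * b z y \<noteq> 0" by (metis (mono_tags) sum.neutral)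
  then have "a x z \<noteq> 0" "b z y \<noteq> 0" by auto
  then show "x \<le> y" using a b by (blast intro: order_trans)
qed

instance
proof
  fix a b c :: "('a, 'b) incalg"
  show "a * b * c = a * (b * c)"
  proof (transfer, intro ext)
    fix a b c :: "'a \<Rightarrow> 'a \<Rightarrow> 'b" and x y
    have "(\<Sum>z\<in>UNIV. (\<Sum>w\<in>UNIV. a x w * b w z) * c z y) =
        (\<Sum>z\<in>UNIV. \<Sum>w\<in>UNIV. a x w * b w z * c z y)"
      by (simp add: sum_distrib_right)
    also have "\<dots> = (\<Sum>w\<in>UNIV. \<Sum>z\<in>UNIV. a x w * b w z * c z y)"
      by (rule sum.swap)
    also have "\<dots> = (\<Sum>w\<in>UNIV. a x w * (\<Sum>z\<in>UNIV. b w z * c z y))"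
      by (simp add: sum_distrib_left mult.assoc)
    finally show "(\<Sum>z\<in>UNIV. (\<Sum>w\<in>UNIV. a x w * b w z) * c z y) =
        (\<Sum>w\<in>UNIV. a x w * (\<Sum>z\<in>UNIV. b w z * c z y))" .
  qed
  show "a + b + c = a + (b + c)" by transfer (simp add: add.assoc)
  show "a + b = b + a" by transfer (simp add: add.commute)
  show "0 + a = a" by transfer simp
  show "- a + a = 0" by transfer simp
  show "a - b = a + - b" by transfer simp
  show "1 * a = a"
    by transfer (simp add: if_distrib[of "\<lambda>t. t * _"] cong: if_cong)
  show "a * 1 = a"
    by transfer (simp add: if_distrib[of "\<lambda>t. _ * t"] cong: if_cong)
  show "(a + b) * c = a * c + b * c"
    by transfer (simp add: distrib_right sum.distrib)
  show "a * (b + c) = a * b + a * c"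
    by transfer (simp add: distrib_left sum.distrib)
  show "(0::('a, 'b) incalg) \<noteq> 1"
    by transfer (metis zero_neq_one)
qed

end

lemma incalg_unit_mult:
  fixes x y z w :: "'x::{finite,order}"
  assumes "x \<le> y" "z \<le> w"
  shows "incalg_unit x y * incalg_unit z w =
    (if y = z then incalg_unit x w else (0 :: ('x, 'k::field) incalg))"
proof -
  have "(\<Sum>t\<in>UNIV. (if x \<le> y \<and> u = x \<and> t = y then 1 else 0) *
      (if z \<le> w \<and> t = z \<and> v = w then 1 else 0)) =
      (if y = z \<and> u = x \<and> v = w then 1 else (0::'k))" for u v
  proof -
    have "(\<Sum>t\<in>UNIV. (if x \<le> y \<and> u = x \<and> t = y then 1 else 0) *
        (if z \<le> w \<and> t = z \<and> v = w then 1 else 0)) =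
        (\<Sum>t\<in>UNIV. if t = y then (if y = z \<and> u = x \<and> v = w then 1 else (0::'k)) else 0)"
      using assms by (intro sum.cong) auto
    then show ?thesis by simp
  qed
  then show ?thesis
    using assms by transfer (auto simp: fun_eq_iff intro: order_trans)
qed

lemma incalg_eq_sum_units:
  fixes a :: "('x::{finite,order}, 'k::field) incalg"
  shows "a = (\<Sum>(x, y) \<in> {(x, y). x \<le> y}. incalg_scale (coeff a x y) (incalg_unit x y))"
proof -
  have coeff_sum: "coeff (sum f A) u v = (\<Sum>i\<in>A. coeff (f i) u v)"
    for f :: "'x \<times> 'x \<Rightarrow> ('x, 'k) incalg" and A u v
    by (induction A rule: infinite_finite_induct)
      (simp_all add: zero_incalg.rep_eq plus_incalg.rep_eq)
  have "coeff a u v =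
      coeff (\<Sum>(x, y) \<in> {(x, y). x \<le> y}. incalg_scale (coeff a x y) (incalg_unit x y)) u v" for u v
  proof -
    have "coeff (\<Sum>(x, y) \<in> {(x, y). x \<le> y}. incalg_scale (coeff a x y) (incalg_unit x y)) u v =
       (\<Sum>p \<in> {(x, y). x \<le> y}. if p = (u, v) then coeff a u v else 0)"
      unfolding coeff_sum
      by (intro sum.cong) (auto simp: incalg_scale.rep_eq incalg_unit.rep_eq split: if_splits)
    also have "\<dots> = (if u \<le> v then coeff a u v else 0)" by simp
    also have "\<dots> = coeff a u v" using coeff[of a] by auto
    finally show ?thesis by simp
  qed
  then have "coeff a =
      coeff (\<Sum>(x, y) \<in> {(x, y). x \<le> y}. incalg_scale (coeff a x y) (incalg_unit x y))"
    by (intro ext)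
  then show ?thesis unfolding coeff_inject .
qed


section \<open>Finite dimensional right modules\<close>

text \<open>
  Modules are carried by finite dimensional subspaces of the space of all functions
  from nat to the field. Every finite dimensional module is isomorphic to one of these.
\<close>

type_synonym 'k kvec = "nat \<Rightarrow> 'k"

definition vscale :: "'k::field \<Rightarrow> 'k kvec \<Rightarrow> 'k kvec" where
  "vscale c v = (\<lambda>i. c * v i)"

definition hscale :: "'k::field \<Rightarrow> ('k kvec \<Rightarrow> 'k kvec) \<Rightarrow> 'k kvec \<Rightarrow> 'k kvec" where
  "hscale c f = (\<lambda>v. vscale c (f v))"

interpretation kvec: vector_space vscale
  by standard (auto simp: vscale_def fun_eq_iff algebra_simps)

interpretation khom: vector_space hscale
  by standard (auto simp: hscale_def vscale_def fun_eq_iff algebra_simps)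

definition fd_module ::
  "'k::field kvec set \<Rightarrow> ('k kvec \<Rightarrow> ('x::{finite,order}, 'k) incalg \<Rightarrow> 'k kvec) \<Rightarrow> bool" where
  "fd_module V act \<longleftrightarrow>
     (\<exists>B. finite B \<and> V = kvec.span B) \<and>
     (\<forall>v\<in>V. \<forall>a. act v a \<in> V) \<and>
     (\<forall>v\<in>V. \<forall>w\<in>V. \<forall>a. act (v + w) a = act v a + act w a) \<and>
     (\<forall>v\<in>V. \<forall>a b. act v (a + b) = act v a + act v b) \<and>
     (\<forall>v\<in>V. \<forall>c a. act (vscale c v) a = vscale c (act v a)) \<and>
     (\<forall>v\<in>V. \<forall>c a. act v (incalg_scale c a) = vscale c (act v a)) \<and>
     (\<forall>v\<in>V. \<forall>a b. act v (a * b) = act (act v a) b) \<and>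
     (\<forall>v\<in>V. act v 1 = v)"

typedef (overloaded) ('x::"{finite,order}", 'k::field) fdmod =
  "{(V, act :: 'k kvec \<Rightarrow> ('x, 'k) incalg \<Rightarrow> 'k kvec). fd_module V act}"
proof
  show "({0}, \<lambda>_ _. 0) \<in> {(V, act :: 'k kvec \<Rightarrow> ('x, 'k) incalg \<Rightarrow> 'k kvec). fd_module V act}"
    by (auto simp: fd_module_def intro!: exI[of _ "{}"])
qed

definition carrier :: "('x::{finite,order}, 'k::field) fdmod \<Rightarrow> 'k kvec set" where
  "carrier M = fst (Rep_fdmod M)"

definition act ::
  "('x::{finite,order}, 'k::field) fdmod \<Rightarrow> 'k kvec \<Rightarrow> ('x, 'k) incalg \<Rightarrow> 'k kvec" where
  "act M = snd (Rep_fdmod M)"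

definition simple_module :: "'x::{finite,order} \<Rightarrow> ('x, 'k::field) fdmod" where
  "simple_module x = Abs_fdmod ({v. \<forall>i>0. v i = 0}, \<lambda>v a. vscale (coeff a x x) v)"

lemma fd_module_simple:
  fixes x :: "'x::{finite,order}"
  shows "fd_module {v. \<forall>i>0. v i = 0} (\<lambda>v (a :: ('x, 'k::field) incalg). vscale (coeff a x x) v)"
proof -
  let ?V = "{v :: 'k kvec. \<forall>i>0. v i = 0}"
  let ?e = "(\<lambda>i. if i = 0 then 1 else 0) :: 'k kvec"
  have "?V = kvec.span {?e}"
  proof -
    have "v = vscale (v 0) ?e" if "v \<in> ?V" for v
      using that by (auto simp: vscale_def fun_eq_iff)
    then show ?thesis
      by (auto simp: kvec.span_singleton vscale_def)
  qed
  then have "\<exists>B. finite B \<and> ?V = kvec.span B" by blast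
  moreover have "coeff (a * b) x x = coeff a x x * coeff b x x" for a b :: "('x, 'k) incalg"
  proof -
    have "(\<Sum>z\<in>UNIV. coeff a x z * coeff b z x) =
        (\<Sum>z\<in>UNIV. if z = x then coeff a x x * coeff b x x else 0)"
      using coeff[of a] coeff[of b] by (intro sum.cong) (auto intro: antisym)
    then show ?thesis by (simp add: times_incalg.rep_eq)
  qed
  ultimately show ?thesis
    unfolding fd_module_def
    by (auto simp: vscale_def fun_eq_iff plus_incalg.rep_eq one_incalg.rep_eq
        incalg_scale.rep_eq algebra_simps)
qed

lemma carrier_simple_module [simp]: "carrier (simple_module x) = {v. \<forall>i>0. v i = 0}"
  and act_simple_module [simp]: "act (simple_module x) v a = vscale (coeff a x x) v"
  by (simp_all add: carrier_def act_def simple_module_def Abs_fdmod_inverse fd_module_simple)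

lemma act_simple_module_unit:
  "y \<le> z \<Longrightarrow> act (simple_module x) v (incalg_unit y z) = (if y = x \<and> z = x then v else 0)"
  by (auto simp: vscale_def fun_eq_iff incalg_unit.rep_eq)

text \<open>
  Homomorphisms are normalised to vanish outside the carrier of the source, so that equality
  of functions is equality of homomorphisms.
\<close>

definition mhom ::
  "('x::{finite,order}, 'k::field) fdmod \<Rightarrow> ('x, 'k) fdmod \<Rightarrow> ('k kvec \<Rightarrow> 'k kvec) set" where
  "mhom M N = {f.
     (\<forall>v. v \<notin> carrier M \<longrightarrow> f v = 0) \<and>
     (\<forall>v\<in>carrier M. f v \<in> carrier N) \<and>
     (\<forall>v\<in>carrier M. \<forall>w\<in>carrier M. f (v + w) = f v + f w) \<and>
     (\<forall>v\<in>carrier M. \<forall>c. f (vscale c v) = vscale c (f v)) \<and>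
     (\<forall>v\<in>carrier M. \<forall>a. f (act M v a) = act N (f v) a)}"

definition mker ::
  "('x::{finite,order}, 'k::field) fdmod \<Rightarrow> ('k kvec \<Rightarrow> 'k kvec) \<Rightarrow> 'k kvec set" where
  "mker M f = {v \<in> carrier M. f v = 0}"

definition short_exact ::
  "('x::{finite,order}, 'k::field) fdmod \<Rightarrow> ('x, 'k) fdmod \<Rightarrow> ('x, 'k) fdmod \<Rightarrow> bool" where
  "short_exact L M N \<longleftrightarrow> (\<exists>f\<in>mhom L M. \<exists>g\<in>mhom M N.
     inj_on f (carrier L) \<and> f ` carrier L = mker M g \<and> g ` carrier M = carrier N)"

definition projective :: "('x::{finite,order}, 'k::field) fdmod \<Rightarrow> bool" where
  "projective P \<longleftrightarrow> (\<forall>(M :: ('x, 'k) fdmod) (N :: ('x, 'k) fdmod). \<forall>g\<in>mhom M N. \<forall>f\<in>mhom P N.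
     g ` carrier M = carrier N \<longrightarrow> (\<exists>h\<in>mhom P M. g \<circ> h = f))"


section \<open>Ext and the Euler form\<close>

definition projective_resolution ::
  "('x::{finite,order}, 'k::field) fdmod \<Rightarrow> (nat \<Rightarrow> ('x, 'k) fdmod) \<Rightarrow>
    (nat \<Rightarrow> 'k kvec \<Rightarrow> 'k kvec) \<Rightarrow> ('k kvec \<Rightarrow> 'k kvec) \<Rightarrow> bool" where
  "projective_resolution M P d e \<longleftrightarrow>
     (\<forall>i. projective (P i)) \<and>
     (\<forall>i. d i \<in> mhom (P (Suc i)) (P i)) \<and>
     e \<in> mhom (P 0) M \<and>
     e ` carrier (P 0) = carrier M \<and>
     d 0 ` carrier (P 1) = mker (P 0) e \<and>
     (\<forall>i. d (Suc i) ` carrier (P (Suc (Suc i))) = mker (P (Suc i)) (d i))"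

definition ext_cocycles ::
  "(nat \<Rightarrow> ('x::{finite,order}, 'k::field) fdmod) \<Rightarrow> (nat \<Rightarrow> 'k kvec \<Rightarrow> 'k kvec) \<Rightarrow>
    ('x, 'k) fdmod \<Rightarrow> nat \<Rightarrow> ('k kvec \<Rightarrow> 'k kvec) set" where
  "ext_cocycles P d N i = {f \<in> mhom (P i) N. f \<circ> d i = (\<lambda>_. 0)}"

definition ext_coboundaries ::
  "(nat \<Rightarrow> ('x::{finite,order}, 'k::field) fdmod) \<Rightarrow> (nat \<Rightarrow> 'k kvec \<Rightarrow> 'k kvec) \<Rightarrow>
    ('x, 'k) fdmod \<Rightarrow> nat \<Rightarrow> ('k kvec \<Rightarrow> 'k kvec) set" where
  "ext_coboundaries P d N i =
     (case i of 0 \<Rightarrow> {\<lambda>_. 0} | Suc j \<Rightarrow> (\<lambda>f. f \<circ> d j) ` mhom (P j) N)"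

text \<open>
  The dimension of the cohomology of \<open>Hom(P, N)\<close> in degree \<open>i\<close>, i.e. of the quotient of the
  cocycles by the coboundaries, for a projective resolution \<open>P\<close> of \<open>M\<close>. All spaces involved are
  finite dimensional, so the dimension of the quotient is the difference of the dimensions.
\<close>

definition ext_dim ::
  "nat \<Rightarrow> ('x::{finite,order}, 'k::field) fdmod \<Rightarrow> ('x, 'k) fdmod \<Rightarrow> nat" where
  "ext_dim i M N = (let (P, d, e) = (SOME (P, d, e). projective_resolution M P d e)
     in khom.dim (ext_cocycles P d N i) - khom.dim (ext_coboundaries P d N i))"

text \<open>Finite global dimension makes the index set of the following sum finite.\<close>

definition euler_char :: "('x::{finite,order}, 'k::field) fdmod \<Rightarrow> ('x, 'k) fdmod \<Rightarrow> int" where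
  "euler_char M N = (\<Sum>i | ext_dim i M N \<noteq> 0. (- 1) ^ i * int (ext_dim i M N))"


section \<open>The Grothendieck group\<close>

inductive_set K0_relations :: "(('x::{finite,order}, 'k::field) fdmod \<Rightarrow>\<^sub>0 int) set" where
  zero: "0 \<in> K0_relations"
| short_exact: "short_exact L M N \<Longrightarrow> frag_of M - frag_of L - frag_of N \<in> K0_relations"
| diff: "a \<in> K0_relations \<Longrightarrow> b \<in> K0_relations \<Longrightarrow> a - b \<in> K0_relations"

lemma K0_relations_uminus: "a \<in> K0_relations \<Longrightarrow> - a \<in> K0_relations"
  using K0_relations.diff[OF K0_relations.zero] by fastforce

lemma K0_relations_add: "a \<in> K0_relations \<Longrightarrow> b \<in> K0_relations \<Longrightarrow> a + b \<in> K0_relations"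
  using K0_relations.diff[OF _ K0_relations_uminus] by fastforce

quotient_type (overloaded) ('x, 'k) K0 = "('x::{finite,order}, 'k::field) fdmod \<Rightarrow>\<^sub>0 int" /
  "\<lambda>a b. a - b \<in> K0_relations"
proof (rule equivpI)
  show "reflp (\<lambda>a b :: ('x, 'k) fdmod \<Rightarrow>\<^sub>0 int. a - b \<in> K0_relations)"
    by (auto simp: reflp_def K0_relations.zero)
  show "symp (\<lambda>a b :: ('x, 'k) fdmod \<Rightarrow>\<^sub>0 int. a - b \<in> K0_relations)"
    unfolding symp_def using K0_relations_uminus by fastforce
  show "transp (\<lambda>a b :: ('x, 'k) fdmod \<Rightarrow>\<^sub>0 int. a - b \<in> K0_relations)"
    unfolding transp_def using K0_relations_add by fastforce
qed

instantiation K0 :: ("{finite,order}", field) ab_group_add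
begin

lift_definition zero_K0 :: "('a, 'b) K0" is 0 .
lift_definition plus_K0 :: "('a, 'b) K0 \<Rightarrow> ('a, 'b) K0 \<Rightarrow> ('a, 'b) K0" is "(+)"
proof -
  fix a b c d :: "('a, 'b) fdmod \<Rightarrow>\<^sub>0 int"
  assume "a - b \<in> K0_relations" "c - d \<in> K0_relations"
  then have "(a - b) + (c - d) \<in> K0_relations" by (rule K0_relations_add)
  then show "a + c - (b + d) \<in> K0_relations" by (simp add: algebra_simps)
qed
lift_definition uminus_K0 :: "('a, 'b) K0 \<Rightarrow> ('a, 'b) K0" is uminus
  using K0_relations_uminus by fastforce
lift_definition minus_K0 :: "('a, 'b) K0 \<Rightarrow> ('a, 'b) K0 \<Rightarrow> ('a, 'b) K0" is "(-)"
proof -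
  fix a b c d :: "('a, 'b) fdmod \<Rightarrow>\<^sub>0 int"
  assume "a - b \<in> K0_relations" "c - d \<in> K0_relations"
  then have "(a - b) - (c - d) \<in> K0_relations" by (rule K0_relations.diff)
  then show "a - c - (b - d) \<in> K0_relations" by (simp add: algebra_simps)
qed

instance
  by standard (transfer; simp add: K0_relations.zero algebra_simps)+

end

lift_definition K0_scale :: "int \<Rightarrow> ('x::{finite,order}, 'k::field) K0 \<Rightarrow> ('x, 'k) K0" is frag_cmul
proof -
  fix n and a b :: "('x, 'k) fdmod \<Rightarrow>\<^sub>0 int"
  assume *: "a - b \<in> K0_relations"
  have nat: "frag_cmul (int m) (a - b) \<in> K0_relations" for m
    by (induction m) (auto simp: frag_cmul_distrib K0_relations.zero K0_relations_add *)
  have "frag_cmul n (a - b) \<in> K0_relations"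
  proof (cases n rule: int_cases2)
    case (nonneg m)
    then show ?thesis using nat by simp
  next
    case (nonpos m)
    then show ?thesis using K0_relations_uminus[OF nat[of m]] by simp
  qed
  then show "frag_cmul n a - frag_cmul n b \<in> K0_relations"
    using frag_cmul_distrib2[of n "a - b" b] by (simp add: algebra_simps)
qed

lift_definition K0_class :: "('x::{finite,order}, 'k::field) fdmod \<Rightarrow> ('x, 'k) K0" is frag_of .

definition euler_form :: "('x::{finite,order}, 'k::field) K0 \<Rightarrow> ('x, 'k) K0 \<Rightarrow> int" where
  "euler_form = (THE B.
     (\<forall>u u' v. B (u + u') v = B u v + B u' v) \<and>
     (\<forall>u v v'. B u (v + v') = B u v + B u v') \<and>
     (\<forall>M N. B (K0_class M) (K0_class N) = euler_char M N))"


section \<open>The Coxeter transformation and the Moebius function\<close>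

definition coxeter :: "('x::{finite,order}, 'k::field) K0 \<Rightarrow> ('x, 'k) K0" where
  "coxeter = (THE \<Phi>. \<forall>u v. euler_form u v = - euler_form v (\<Phi> u))"

definition simple_coord :: "('x::{finite,order}, 'k::field) K0 \<Rightarrow> 'x \<Rightarrow> int" where
  "simple_coord u = (THE c. u = (\<Sum>x\<in>UNIV. K0_scale (c x) (K0_class (simple_module x))))"

text \<open>Acting on column vectors: column \<open>y\<close> holds the coordinates of the image of the class
  of the simple module at \<open>y\<close>.\<close>

definition coxeter_matrix :: "'k::field itself \<Rightarrow> int ^ 'x::{finite,order} ^ 'x::{finite,order}" where
  "coxeter_matrix _ =
     (\<chi> x y. simple_coord (coxeter (K0_class (simple_module y) :: ('x, 'k) K0)) x)"

definition incidence_matrix :: "int ^ 'x::{finite,order} ^ 'x::{finite,order}" where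
  "incidence_matrix = (\<chi> x y. if x \<le> y then 1 else 0)"

definition moebius :: "'x::{finite,order} \<Rightarrow> 'x \<Rightarrow> int" where
  "moebius x y = matrix_inv incidence_matrix $ x $ y"

end

theory Submission
  imports Defs
begin

text \<open>
  Write \<open>I y\<close> for the injective hull of the simple module \<open>S y\<close>. The functor \<open>Hom (_, I y)\<close> is dual to
  taking the weight space at \<open>y\<close>, hence exact, so the Euler characteristic of \<open>M\<close> and \<open>I y\<close> is the
  dimension of that weight space of \<open>M\<close>. The composition factors of \<open>I y\<close> are the \<open>S x\<close> with \<open>x \<le> y\<close>, each
  occurring once. Since the Euler characteristic is additive in its second argument, the matrix of the
  Euler form on the simple modules is a left inverse of the incidence matrix, so its entries are the
  values of the Moebius function. The Coxeter matrix is minus the incidence matrix times the transpose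
  of that matrix.

  Additivity in the second argument only involves the one projective resolution chosen in the
  definition of Ext, so no comparison of resolutions is needed; additivity in the first argument
  follows from the resulting formula in terms of dimension vectors. That Ext vanishes in large degrees
  comes from shifting dimensions along \<open>S x \<rightarrow> I x\<close>, whose cokernel has factors \<open>S z\<close> with \<open>z < x\<close> only.
\<close>

text \<open>Injective modules are the right test objects because the resolution behind
  \<open>ext_dim\<close> is an arbitrary choice: nothing is known about its terms, but Hom into an
  injective turns any projective resolution into a complex that is exact in positive degrees. The
  choice operators and descriptions in the definitions say something only after existence, and for
  the descriptions also uniqueness, has been shown; hence the work on projective resolutions, on a
  basis of the Grothendieck group and on nondegeneracy. All modules are subspaces of one infinite
  dimensional space of functions on \<open>nat\<close>, so finite dimensionality is a property of
  each subspace, quotients are realised on complements, and direct sums by coding pairs as numbers.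
  The comparison with injectives inverts the incidence matrix on one side only, over the integers;
  Moebius inversion uses both sides, so the reals enter briefly.\<close>

definition fin_subspace :: "('k::field \<Rightarrow> 'v::ab_group_add \<Rightarrow> 'v) \<Rightarrow> 'v set \<Rightarrow> bool" where
  "fin_subspace s V \<longleftrightarrow> (\<exists>B. finite B \<and> V = module.span s B)"

section \<open>Finite dimensional subspaces and maps linear on them\<close>

context vector_space
begin

lemma fin_subspace_span: "finite B \<Longrightarrow> fin_subspace scale (span B)"
  by (auto simp: fin_subspace_def)

lemma fin_subspace_imp_subspace: "fin_subspace scale V \<Longrightarrow> subspace V"
  by (auto simp: fin_subspace_def)

lemma fin_subspace_subset:
  assumes "fin_subspace scale V" "subspace W" "W \<subseteq> V"
  shows "fin_subspace scale W"
proof -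
  obtain B where B: "finite B" "V = span B" using assms(1) by (auto simp: fin_subspace_def)
  obtain C where C: "C \<subseteq> W" "independent C" "W \<subseteq> span C"
    by (rule maximal_independent_subset)
  have "finite C" using independent_span_bound[OF B(1) C(2)] C(1) assms(3) B(2) by blast
  moreover have "W = span C" using C assms(2) by (simp add: span_subspace)
  ultimately show ?thesis by (auto simp: fin_subspace_def)
qed

lemma extend_basis_fin_subspace:
  assumes "fin_subspace scale V" "A \<subseteq> V" "independent A"
  obtains B where "A \<subseteq> B" "independent B" "finite B" "V = span B"
proof -
  obtain B0 where B0: "finite B0" "V = span B0" using assms(1) by (auto simp: fin_subspace_def)
  obtain B where B: "A \<subseteq> B" "B \<subseteq> V" "independent B" "V \<subseteq> span B"
    using maximal_independent_subset_extend[OF assms(2,3)] by blast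
  have "finite B" using independent_span_bound[OF B0(1) B(3)] B(2) B0(2) by blast
  moreover have "V = span B"
    using B assms(1) by (simp add: span_subspace fin_subspace_imp_subspace)
  ultimately show thesis using that B by blast
qed

lemma fin_subspace_basis:
  assumes "fin_subspace scale V"
  obtains B where "independent B" "finite B" "V = span B" "card B = dim V"
proof -
  obtain B where "independent B" "finite B" "V = span B"
    using extend_basis_fin_subspace[OF assms, of "{}"] by (auto simp: independent_empty)
  then show thesis using that[of B] by (simp add: dim_eq_card_independent)
qed

lemma dim_mono_fin_subspace:
  assumes "fin_subspace scale V" "W \<subseteq> V"
  shows "dim W \<le> dim V"
proof -
  obtain B where B: "independent B" "finite B" "V = span B" "card B = dim V"
    using fin_subspace_basis[OF assms(1)] .
  show ?thesis using dim_le_card[of W B] B assms(2) by simp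
qed

text \<open>The difference of natural numbers is truncated, so it vanishes as soon as
  \<open>dim V \<le> dim W\<close>; a basis of \<open>W\<close> extended to one of \<open>V\<close>
  then cannot grow. The form with a difference matches the way Ext dimensions are given.\<close>

lemma fin_subspace_eq_iff_dim:
  assumes "fin_subspace scale V" "subspace W" "W \<subseteq> V"
  shows "dim V - dim W = 0 \<longleftrightarrow> V = W"
proof
  assume *: "dim V - dim W = 0"
  obtain A where A: "independent A" "finite A" "W = span A" "card A = dim W"
    using fin_subspace_basis[OF fin_subspace_subset[OF assms]] .
  obtain B where B: "A \<subseteq> B" "independent B" "finite B" "V = span B"
    using extend_basis_fin_subspace[OF assms(1) _ A(1)] assms(3) A(3) span_superset[of A] by auto
  have "card B \<le> card A" using * A(4) B(2,4) by (simp add: dim_eq_card_independent)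
  then have "A = B" using B(1,3) by (metis card_seteq)
  then show "V = W" using A(3) B(4) by simp
qed simp

lemma dim_zero_subspace [simp]: "dim {0} = 0"
  using dim_eq_card_independent[OF independent_empty] dim_span[of "{}"] by simp

lemma dim_fin_subspace_eq_0_iff:
  assumes "fin_subspace scale V"
  shows "dim V = 0 \<longleftrightarrow> V = {0}"
  using fin_subspace_eq_iff_dim[OF assms, of "{0}"]
    fin_subspace_imp_subspace[OF assms] subspace_0 by auto

lemma dim_line: "v \<noteq> 0 \<Longrightarrow> dim (range (\<lambda>c. c *s v)) = 1"
  using dim_span_eq_card_independent[of "{v}"] by (simp add: span_singleton)

lemma span_Int_Diff_independent:
  assumes B: "independent B" and "A \<subseteq> B" and x: "x \<in> span A" "x \<in> span (B - A)"
  shows "x = 0"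
proof -
  have "representation B x = representation A x"
    using representation_extend[OF B x(1)] assms(2) by blast
  moreover have "representation B x = representation (B - A) x"
    using representation_extend[OF B x(2)] by blast
  ultimately have "representation B x b = 0" for b
    using representation_ne_zero[of A x b] representation_ne_zero[of "B - A" x b] by (metis DiffD2)
  then show ?thesis
    using sum_nonzero_representation_eq[OF B, of x] span_mono[OF assms(2)] x(1) by auto
qed

lemma independent_mono_Diff: "independent B \<Longrightarrow> independent (B - A)"
  using dependent_mono by blast

end

text \<open>Homomorphisms are normalised to vanish outside the carrier, so they are linear only on it.\<close>

definition linear_on :: "('a \<Rightarrow> 'b \<Rightarrow> 'b) \<Rightarrow> ('a \<Rightarrow> 'c \<Rightarrow> 'c) \<Rightarrow> 'b set \<Rightarrow> ('b::plus \<Rightarrow> 'c::plus) \<Rightarrow> bool" where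
  "linear_on s1 s2 V f \<longleftrightarrow> (\<forall>v\<in>V. \<forall>w\<in>V. f (v + w) = f v + f w) \<and> (\<forall>v\<in>V. \<forall>c. f (s1 c v) = s2 c (f v))"

lemma linear_on_subset: "linear_on s1 s2 V f \<Longrightarrow> W \<subseteq> V \<Longrightarrow> linear_on s1 s2 W f"
  unfolding linear_on_def by blast

context vector_space_pair
begin

text \<open>Values on a basis of \<open>V\<close> extend to a globally linear \<open>F\<close>, and
  the vectors of \<open>V\<close> where \<open>F\<close> agrees with \<open>f\<close> form a
  subspace containing that basis. This makes facts on linear maps available for homomorphisms cut
  off outside their carrier.\<close>

lemma linear_on_extend:
  assumes V: "vs1.subspace V" and f: "linear_on s1 s2 V f"
  obtains F where "Vector_Spaces.linear s1 s2 F" "\<And>v. v \<in> V \<Longrightarrow> F v = f v"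
proof -
  obtain B where B: "B \<subseteq> V" "vs1.independent B" "V \<subseteq> vs1.span B"
    by (rule vs1.maximal_independent_subset)
  obtain F where F: "Vector_Spaces.linear s1 s2 F" "\<And>b. b \<in> B \<Longrightarrow> F b = f b"
    using linear_independent_extend[OF B(2)] by metis
  interpret F: Vector_Spaces.linear s1 s2 F by (rule F(1))
  have f0: "f 0 = 0"
    using f vs1.subspace_0[OF V] unfolding linear_on_def by (metis add_cancel_right_left)
  have "vs1.subspace {v \<in> V. F v = f v}"
    using V f f0 by (auto simp: vs1.subspace_def linear_on_def F.add F.scale F.zero)
  then have "V \<subseteq> {v \<in> V. F v = f v}"
    using B F(2) vs1.span_minimal[of B "{v \<in> V. F v = f v}"] by blast
  then show thesis using that F(1) by blast
qed

lemma
  assumes V: "vs1.subspace V" and f: "linear_on s1 s2 V f"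
  shows subspace_linear_on_kernel: "vs1.subspace {v \<in> V. f v = 0}"
    and subspace_linear_on_image: "vs2.subspace (f ` V)"
    and linear_on_0: "f 0 = 0"
proof -
  obtain F where F: "Vector_Spaces.linear s1 s2 F" "\<And>v. v \<in> V \<Longrightarrow> F v = f v"
    using linear_on_extend[OF assms] by blast
  interpret F: Vector_Spaces.linear s1 s2 F by (rule F(1))
  have "{v \<in> V. f v = 0} = V \<inter> {v. F v = 0}" using F(2) by auto
  then show "vs1.subspace {v \<in> V. f v = 0}"
    using vs1.subspace_inter[OF V F.subspace_kernel] by simp
  have "f ` V = F ` V" using F(2) by force
  then show "vs2.subspace (f ` V)" using F.subspace_image[OF V] by simp
  show "f 0 = 0" using F(2)[OF vs1.subspace_0[OF V]] F.zero by simp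
qed

text \<open>A basis \<open>A\<close> of the kernel is completed to a basis \<open>B\<close> of
  \<open>V\<close>; the added vectors \<open>C\<close> span a complement on which the map is
  injective, and their images form a basis of the image.\<close>

lemma
  assumes V: "fin_subspace s1 V" and f: "linear_on s1 s2 V f"
  shows fin_subspace_linear_on_image: "fin_subspace s2 (f ` V)"
    and rank_nullity: "vs1.dim V = vs2.dim (f ` V) + vs1.dim {v \<in> V. f v = 0}"
proof -
  note sub = vs1.fin_subspace_imp_subspace[OF V]
  obtain F where F: "Vector_Spaces.linear s1 s2 F" "\<And>v. v \<in> V \<Longrightarrow> F v = f v"
    using linear_on_extend[OF sub f] by blast
  interpret F: Vector_Spaces.linear s1 s2 F by (rule F(1))
  have fV: "f ` V = F ` V" using F(2) by force
  have K: "fin_subspace s1 {v \<in> V. f v = 0}"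
    by (rule vs1.fin_subspace_subset[OF V subspace_linear_on_kernel[OF sub f]]) auto
  obtain A where A: "vs1.independent A" "finite A" "{v \<in> V. f v = 0} = vs1.span A"
      "card A = vs1.dim {v \<in> V. f v = 0}"
    using vs1.fin_subspace_basis[OF K] .
  obtain B where B: "A \<subseteq> B" "vs1.independent B" "finite B" "V = vs1.span B"
    using vs1.extend_basis_fin_subspace[OF V _ A(1)] A(3) vs1.span_superset
    by (metis (no_types, lifting) mem_Collect_eq subset_eq)
  define C where "C = B - A"
  have CV: "vs1.span C \<subseteq> V" unfolding B(4) C_def by (intro vs1.span_mono) auto
  have inj: "inj_on F (vs1.span C)"
  proof (rule F.inj_on_iff_eq_0[THEN iffD2, OF vs1.subspace_span], intro ballI impI)
    fix x assume x: "x \<in> vs1.span C" "F x = 0"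
    then have "x \<in> vs1.span A" using A(3) F(2) CV by fastforce
    then show "x = 0" using vs1.span_Int_Diff_independent[OF B(2,1)] x(1) C_def by blast
  qed
  have "vs1.independent C" unfolding C_def using vs1.independent_mono_Diff[OF B(2)] .
  then have ind: "vs2.independent (F ` C)" using F.independent_injective_image inj by blast
  have "F ` V = vs2.span (F ` C)"
  proof
    show "vs2.span (F ` C) \<subseteq> F ` V" using CV by (auto simp: F.span_image)
    show "F ` V \<subseteq> vs2.span (F ` C)"
    proof clarify
      fix v assume "v \<in> V"
      then obtain a c where v: "v = a + c" "a \<in> vs1.span A" "c \<in> vs1.span C"
        using vs1.span_Un[of A C] B(1,4) unfolding C_def
        by (smt (verit) Un_Diff_cancel mem_Collect_eq subset_Un_eq)
      then have "a \<in> {v \<in> V. f v = 0}" using A(3) by simp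
      then have "F a = 0" using F(2) by simp
      then show "F v \<in> vs2.span (F ` C)" using v by (simp add: F.add F.span_image)
    qed
  qed
  then have img: "f ` V = vs2.span (F ` C)" using fV by simp
  then show "fin_subspace s2 (f ` V)"
    using finite_imageI[of C F] B(3) unfolding fin_subspace_def C_def by blast
  have "card (F ` C) = card C"
    using inj vs1.span_superset by (metis card_image inj_on_subset)
  moreover have "card B = card A + card C"
    unfolding C_def using B(1,3) A(2) by (simp add: card_Diff_subset card_mono)
  ultimately show "vs1.dim V = vs2.dim (f ` V) + vs1.dim {v \<in> V. f v = 0}"
    using A(4) ind B(2,4) unfolding img
    by (simp add: vs2.dim_eq_card_independent vs1.dim_eq_card_independent)
qed

lemma dim_inj_image:
  assumes V: "fin_subspace s1 V" and f: "linear_on s1 s2 V f" and "inj_on f V"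
  shows "vs2.dim (f ` V) = vs1.dim V"
proof -
  have "{v \<in> V. f v = 0} = {0}"
    using assms(3) linear_on_0[OF vs1.fin_subspace_imp_subspace[OF V] f]
      vs1.subspace_0[OF vs1.fin_subspace_imp_subspace[OF V]]
    by (auto simp: inj_on_def)
  then show ?thesis using rank_nullity[OF V f] by simp
qed

end

interpretation kvec_pair: vector_space_pair vscale vscale ..
interpretation khom_pair: vector_space_pair hscale hscale ..

section \<open>Matrix units in the incidence algebra\<close>

lemma coeff_sum: "coeff (sum f A) u v = (\<Sum>i\<in>A. coeff (f i) u v)"
  for f :: "'i \<Rightarrow> ('x::{finite,order}, 'k::field) incalg"
  by (induction A rule: infinite_finite_induct)
    (simp_all add: zero_incalg.rep_eq plus_incalg.rep_eq)

lemma incalg_eqI: "(\<And>u v. coeff a u v = coeff b u v) \<Longrightarrow> a = b"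
  by (meson coeff_inject ext)

lemma coeff_eq_0: "\<not> x \<le> y \<Longrightarrow> coeff a x y = 0"
  using coeff[of a] by auto

lemma coeff_unit: "coeff (incalg_unit x y) u v = (if x \<le> y \<and> u = x \<and> v = y then 1 else 0)"
  by (simp add: incalg_unit.rep_eq)

lemma incalg_unit_eq_0: "\<not> x \<le> y \<Longrightarrow> incalg_unit x y = (0 :: ('x::{finite,order}, 'k::field) incalg)"
  by (rule incalg_eqI) (simp add: coeff_unit zero_incalg.rep_eq)

lemma incalg_one_eq_sum: "(1 :: ('x::{finite,order}, 'k::field) incalg) = (\<Sum>x\<in>UNIV. incalg_unit x x)"
proof (rule incalg_eqI)
  fix u v :: 'x
  have "(\<Sum>x\<in>UNIV. coeff (incalg_unit x x :: ('x, 'k) incalg) u v) =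
      (\<Sum>x\<in>UNIV. if x = u then (if u = v then 1 else 0) else 0)"
    by (intro sum.cong) (auto simp: coeff_unit)
  then show "coeff (1 :: ('x, 'k) incalg) u v = coeff (\<Sum>x\<in>UNIV. incalg_unit x x) u v"
    by (simp add: coeff_sum one_incalg.rep_eq)
qed

lemma incalg_unit_times:
  fixes a :: "('x::{finite,order}, 'k::field) incalg"
  assumes "x \<le> u"
  shows "incalg_unit x u * a = (\<Sum>y\<in>UNIV. incalg_scale (coeff a u y) (incalg_unit x y))"
proof (rule incalg_eqI)
  fix p q
  have "(\<Sum>z\<in>UNIV. coeff (incalg_unit x u :: ('x, 'k) incalg) p z * coeff a z q) =
     (\<Sum>z\<in>UNIV. if z = u then (if p = x then coeff a u q else 0) else 0)"
    using assms by (intro sum.cong) (auto simp: coeff_unit)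
  moreover have "(\<Sum>y\<in>UNIV. coeff a u y * coeff (incalg_unit x y :: ('x, 'k) incalg) p q) =
     (\<Sum>y\<in>UNIV. if y = q then (if p = x then coeff a u q else 0) else 0)"
    using assms order_trans[OF assms, of q] coeff_eq_0[of u q a]
    by (intro sum.cong) (auto simp: coeff_unit)
  ultimately show "coeff (incalg_unit x u * a) p q =
      coeff (\<Sum>y\<in>UNIV. incalg_scale (coeff a u y) (incalg_unit x y)) p q"
    by (simp add: times_incalg.rep_eq coeff_sum incalg_scale.rep_eq)
qed

lemma incalg_unit_mult':
  "incalg_unit x y * incalg_unit z w =
    (if y = z \<and> x \<le> y \<and> z \<le> w then incalg_unit x w else (0 :: ('x::{finite,order}, 'k::field) incalg))"
  using incalg_unit_mult[of x y z w, where 'k='k] incalg_unit_eq_0[of x y, where 'k='k]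
    incalg_unit_eq_0[of z w, where 'k='k] by (cases "x \<le> y \<and> z \<le> w") auto

section \<open>Consequences of the module axioms\<close>

lemma fd_module_carrier_act: "fd_module (carrier M) (act M)"
  using Rep_fdmod[of M] by (auto simp: carrier_def act_def)

context
  fixes M :: "('x::{finite,order}, 'k::field) fdmod"
begin

lemma fin_subspace_carrier: "fin_subspace vscale (carrier M)"
  using fd_module_carrier_act[of M] by (auto simp: fd_module_def fin_subspace_def)

lemma subspace_carrier: "kvec.subspace (carrier M)"
  using kvec.fin_subspace_imp_subspace[OF fin_subspace_carrier] .

lemma zero_carrier [simp]: "0 \<in> carrier M"
  and add_carrier [intro]: "v \<in> carrier M \<Longrightarrow> w \<in> carrier M \<Longrightarrow> v + w \<in> carrier M"
  and diff_carrier [intro]: "v \<in> carrier M \<Longrightarrow> w \<in> carrier M \<Longrightarrow> v - w \<in> carrier M"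
  and scale_carrier [intro]: "v \<in> carrier M \<Longrightarrow> vscale c v \<in> carrier M"
  and sum_carrier: "(\<And>i. i \<in> I \<Longrightarrow> h i \<in> carrier M) \<Longrightarrow> sum h I \<in> carrier M"
  using subspace_carrier
  by (auto simp: kvec.subspace_0 kvec.subspace_add kvec.subspace_scale kvec.subspace_diff kvec.subspace_sum)

lemma
  assumes "v \<in> carrier M"
  shows act_carrier [intro]: "act M v a \<in> carrier M"
    and act_add_left: "w \<in> carrier M \<Longrightarrow> act M (v + w) a = act M v a + act M w a"
    and act_scale_left: "act M (vscale c v) a = vscale c (act M v a)"
    and act_add_right: "act M v (a + b) = act M v a + act M v b"
    and act_scale_right: "act M v (incalg_scale c a) = vscale c (act M v a)"
    and act_mult: "act M v (a * b) = act M (act M v a) b"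
    and act_one: "act M v 1 = v"
  using fd_module_carrier_act[of M] assms by (auto simp: fd_module_def)

lemma linear_on_act: "linear_on vscale vscale (carrier M) (\<lambda>v. act M v a)"
  by (simp add: linear_on_def act_add_left act_scale_left)

lemma act_zero_left [simp]: "act M 0 a = 0"
  using kvec_pair.linear_on_0[OF subspace_carrier linear_on_act] .

lemma act_zero_right [simp]: "v \<in> carrier M \<Longrightarrow> act M v 0 = 0"
  using act_add_right[of v 0 0] by simp

lemma act_sum_right: "v \<in> carrier M \<Longrightarrow> act M v (sum b I) = (\<Sum>i\<in>I. act M v (b i))"
  by (induction I rule: infinite_finite_induct) (simp_all add: act_add_right)

lemma act_unit_unit:
  "v \<in> carrier M \<Longrightarrow> act M (act M v (incalg_unit x y)) (incalg_unit z w) =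
    (if y = z \<and> x \<le> y \<and> z \<le> w then act M v (incalg_unit x w) else 0)"
  by (auto simp: act_mult[symmetric] incalg_unit_mult' intro: order_trans)

lemma act_unit_act:
  "v \<in> carrier M \<Longrightarrow> x \<le> u \<Longrightarrow> act M (act M v (incalg_unit x u)) a =
    (\<Sum>y\<in>UNIV. vscale (coeff a u y) (act M v (incalg_unit x y)))"
  by (simp add: act_mult[symmetric] incalg_unit_times act_sum_right act_scale_right)

lemma eq_sum_act_unit: "v \<in> carrier M \<Longrightarrow> v = (\<Sum>x\<in>UNIV. act M v (incalg_unit x x))"
  by (metis act_one act_sum_right incalg_one_eq_sum)

end

lemma linear_on_sum:
  assumes "kvec.subspace V" "linear_on vscale vscale V f" "\<And>i. i \<in> I \<Longrightarrow> h i \<in> V"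
  shows "f (sum h I) = (\<Sum>i\<in>I. f (h i))"
  using assms(3)
proof (induction I rule: infinite_finite_induct)
  case (insert i I)
  then have "h i \<in> V" "sum h I \<in> V" using kvec.subspace_sum[OF assms(1), of I h] by blast+
  then have "f (h i + sum h I) = f (h i) + f (sum h I)" using assms(2) unfolding linear_on_def by blast
  with insert show ?case by (simp only: sum.insert insert_iff simp_thms)
qed (auto simp: kvec_pair.linear_on_0[OF assms(1,2)])

lemma act_sum_left:
  "(\<And>i. i \<in> I \<Longrightarrow> h i \<in> carrier M) \<Longrightarrow> act M (sum h I) a = (\<Sum>i\<in>I. act M (h i) a)"
  by (rule linear_on_sum[OF subspace_carrier linear_on_act])

section \<open>Weight spaces\<close>

text \<open>The space attached to \<open>x\<close> when the module is read as a representation of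
  the poset. Its dimension equals the multiplicity of the simple module at \<open>x\<close> as a
  composition factor.\<close>

definition weight_space :: "('x::{finite,order}, 'k::field) fdmod \<Rightarrow> 'x \<Rightarrow> 'k kvec set" where
  "weight_space M x = {v \<in> carrier M. act M v (incalg_unit x x) = v}"

definition dimvec :: "('x::{finite,order}, 'k::field) fdmod \<Rightarrow> 'x \<Rightarrow> nat" where
  "dimvec M x = kvec.dim (weight_space M x)"

lemma weight_space_carrier: "v \<in> weight_space M x \<Longrightarrow> v \<in> carrier M"
  by (simp add: weight_space_def)

lemma subspace_weight_space: "kvec.subspace (weight_space M x)"
  by (auto simp: kvec.subspace_def weight_space_def act_add_left act_scale_left)

lemma fin_subspace_weight_space: "fin_subspace vscale (weight_space M x)"
  by (rule kvec.fin_subspace_subset[OF fin_subspace_carrier subspace_weight_space]) (auto simp: weight_space_def)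

lemma act_unit_weight_space: "v \<in> carrier M \<Longrightarrow> act M v (incalg_unit x y) \<in> weight_space M y"
  by (cases "x \<le> y") (auto simp: weight_space_def act_unit_unit incalg_unit_eq_0)

lemma act_weight_space:
  assumes "v \<in> weight_space M x"
  shows "act M v a = (\<Sum>y\<in>UNIV. vscale (coeff a x y) (act M v (incalg_unit x y)))"
  using act_unit_act[of v M x x a] assms by (simp add: weight_space_def)

lemma dimvec_eq_0_iff: "dimvec M x = 0 \<longleftrightarrow> weight_space M x = {0}"
  unfolding dimvec_def by (rule kvec.dim_fin_subspace_eq_0_iff[OF fin_subspace_weight_space])

section \<open>Homomorphisms\<close>

lemma mhomI:
  assumes "\<And>v. v \<notin> carrier M \<Longrightarrow> f v = 0" "\<And>v. v \<in> carrier M \<Longrightarrow> f v \<in> carrier N"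
    "linear_on vscale vscale (carrier M) f"
    "\<And>v a. v \<in> carrier M \<Longrightarrow> f (act M v a) = act N (f v) a"
  shows "f \<in> mhom M N"
  using assms by (auto simp: mhom_def linear_on_def)

context
  fixes f M N assumes f: "f \<in> mhom M N"
begin

lemma mhom_outside: "v \<notin> carrier M \<Longrightarrow> f v = 0"
  and mhom_carrier: "v \<in> carrier M \<Longrightarrow> f v \<in> carrier N"
  and mhom_add: "v \<in> carrier M \<Longrightarrow> w \<in> carrier M \<Longrightarrow> f (v + w) = f v + f w"
  and mhom_scale: "v \<in> carrier M \<Longrightarrow> f (vscale c v) = vscale c (f v)"
  and mhom_act: "v \<in> carrier M \<Longrightarrow> f (act M v a) = act N (f v) a"
  using f by (auto simp: mhom_def)

lemma mhom_carrier': "f v \<in> carrier N"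
  by (cases "v \<in> carrier M") (simp_all add: mhom_carrier mhom_outside)

lemma linear_on_mhom: "linear_on vscale vscale (carrier M) f"
  using f by (auto simp: mhom_def linear_on_def)

lemma mhom_zero: "f 0 = 0"
  using kvec_pair.linear_on_0[OF subspace_carrier linear_on_mhom] .

lemma mhom_diff: "v \<in> carrier M \<Longrightarrow> w \<in> carrier M \<Longrightarrow> f (v - w) = f v - f w"
  using mhom_add[of "v - w" w] diff_carrier[of v M w] by (simp add: eq_diff_eq)

lemma mhom_sum: "(\<And>i. i \<in> I \<Longrightarrow> h i \<in> carrier M) \<Longrightarrow> f (sum h I) = (\<Sum>i\<in>I. f (h i))"
  by (rule linear_on_sum[OF subspace_carrier linear_on_mhom])

lemma mhom_weight_space: "v \<in> weight_space M x \<Longrightarrow> f v \<in> weight_space N x"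
  by (metis (mono_tags, lifting) weight_space_def mem_Collect_eq mhom_act mhom_carrier)

lemma linear_on_mhom_weight_space: "linear_on vscale vscale (weight_space M x) f"
  by (rule linear_on_subset[OF linear_on_mhom]) (auto simp: weight_space_def)

lemma subspace_mker: "kvec.subspace (mker M f)"
  unfolding mker_def by (rule kvec_pair.subspace_linear_on_kernel[OF subspace_carrier linear_on_mhom])

lemma act_mker: "v \<in> mker M f \<Longrightarrow> act M v a \<in> mker M f"
  by (auto simp: mker_def mhom_act)

end

lemma mhom_compose:
  assumes g: "g \<in> mhom M N" and f: "f \<in> mhom L M"
  shows "g \<circ> f \<in> mhom L N"
proof (rule mhomI)
  show "linear_on vscale vscale (carrier L) (g \<circ> f)"
    using mhom_add[OF g mhom_carrier[OF f] mhom_carrier[OF f]] mhom_scale[OF g mhom_carrier[OF f]]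
    by (simp add: linear_on_def mhom_add[OF f] mhom_scale[OF f])
qed (simp_all add: mhom_outside[OF f] mhom_zero[OF g] mhom_carrier[OF f] mhom_carrier[OF g]
    mhom_act[OF f] mhom_act[OF g])

lemma zero_mhom: "(\<lambda>_. 0) \<in> mhom M N"
  by (rule mhomI) (auto simp: linear_on_def)

lemma subspace_mhom: "khom.subspace (mhom M N)"
  unfolding khom.subspace_def
proof (intro conjI ballI allI)
  show "0 \<in> mhom M N" using zero_mhom[of M N] by (simp add: zero_fun_def)
  fix f g c assume fg: "f \<in> mhom M N"
  show "hscale c f \<in> mhom M N"
    by (rule mhomI) (auto simp: hscale_def mhom_outside[OF fg] mhom_carrier[OF fg] linear_on_def
      mhom_add[OF fg] mhom_scale[OF fg] mhom_act[OF fg] act_scale_left kvec.scale_right_distrib mult.commute)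
  assume g: "g \<in> mhom M N"
  show "f + g \<in> mhom M N"
    by (rule mhomI) (auto simp: mhom_outside[OF fg] mhom_carrier[OF fg] linear_on_def
      mhom_add[OF fg] mhom_scale[OF fg] mhom_act[OF fg] mhom_outside[OF g] mhom_carrier[OF g]
      mhom_add[OF g] mhom_scale[OF g] mhom_act[OF g] act_add_left kvec.scale_right_distrib)
qed

lemma mhom_eqI:
  assumes "f \<in> mhom M N" "g \<in> mhom M N" "\<And>v. v \<in> carrier M \<Longrightarrow> f v = g v"
  shows "f = g"
  using assms by (metis ext mhom_outside)

lemma linear_precompose: "linear_on hscale hscale V (\<lambda>f. f \<circ> d)"
  by (auto simp: linear_on_def hscale_def fun_eq_iff)

lemma linear_on_postcompose:
  assumes "g \<in> mhom M N"
  shows "linear_on hscale hscale (mhom P M) (\<lambda>f. g \<circ> f)"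
  unfolding linear_on_def
proof (intro conjI ballI allI)
  fix f h c assume f: "f \<in> mhom P M"
  show "g \<circ> hscale c f = hscale c (g \<circ> f)"
    using mhom_scale[OF assms mhom_carrier'[OF f]] by (auto simp: hscale_def fun_eq_iff)
  assume h: "h \<in> mhom P M"
  show "g \<circ> (f + h) = (g \<circ> f) + (g \<circ> h)"
    using mhom_add[OF assms mhom_carrier'[OF f] mhom_carrier'[OF h]] by (auto simp: fun_eq_iff)
qed

text \<open>For bases \<open>B\<close> and \<open>C\<close> of the carriers, the maps
  \<open>E (b, c)\<close> are elementary matrices, cut off outside the carrier of \<open>M\<close>.
  Their span contains all homomorphisms, although a single \<open>E (b, c)\<close> may fail to be
  one.\<close>

lemma fin_subspace_mhom: "fin_subspace hscale (mhom M N)"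
proof -
  obtain B where B: "kvec.independent B" "finite B" "carrier M = kvec.span B"
    using kvec.fin_subspace_basis[OF fin_subspace_carrier] by blast
  obtain C where C: "kvec.independent C" "finite C" "carrier N = kvec.span C"
    using kvec.fin_subspace_basis[OF fin_subspace_carrier] by blast
  define E where "E = (\<lambda>(b, c) v. if v \<in> carrier M then vscale (kvec.representation B v b) c else 0)"
  have "f \<in> khom.span (E ` (B \<times> C))" if f: "f \<in> mhom M N" for f
  proof -
    have "f = (\<Sum>p \<in> B \<times> C. hscale (kvec.representation C (f (fst p)) (snd p)) (E p))"
    proof
      fix v
      have app: "sum h I v = (\<Sum>i\<in>I. h i v)" for I and h :: "'x \<Rightarrow> 'y \<Rightarrow> 'z::comm_monoid_add" and v
        by (induction I rule: infinite_finite_induct) auto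
      show "f v = (\<Sum>p \<in> B \<times> C. hscale (kvec.representation C (f (fst p)) (snd p)) (E p)) v"
      proof (cases "v \<in> carrier M")
        case True
        have b: "b \<in> carrier M" if "b \<in> B" for b using that B(3) kvec.span_base by auto
        have "v = (\<Sum>b\<in>B. vscale (kvec.representation B v b) b)"
          using kvec.sum_representation_eq[OF B(1) _ B(2) order_refl, of v] True B(3) by simp
        then have "f v = (\<Sum>b\<in>B. f (vscale (kvec.representation B v b) b))"
          using mhom_sum[OF f, of B "\<lambda>b. vscale (kvec.representation B v b) b"] b by auto
        also have "\<dots> = (\<Sum>b\<in>B. vscale (kvec.representation B v b) (f b))"
          using b by (intro sum.cong) (auto simp: mhom_scale[OF f])
        also have "\<dots> = (\<Sum>b\<in>B. vscale (kvec.representation B v b)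
            (\<Sum>c\<in>C. vscale (kvec.representation C (f b) c) c))"
          using kvec.sum_representation_eq[OF C(1) _ C(2) order_refl] mhom_carrier[OF f] b C(3)
          by (intro sum.cong) auto
        also have "\<dots> = (\<Sum>p \<in> B \<times> C. hscale (kvec.representation C (f (fst p)) (snd p)) (E p) v)"
          using True by (simp add: sum.cartesian_product case_prod_unfold kvec.scale_sum_right
            hscale_def E_def mult.commute)
        finally show ?thesis by (simp add: app)
      next
        case False
        then show ?thesis by (simp add: app hscale_def E_def case_prod_unfold mhom_outside[OF f])
      qed
    qed
    moreover have "\<dots> \<in> khom.span (E ` (B \<times> C))"
      by (intro khom.span_sum khom.span_scale khom.span_base) auto
    ultimately show ?thesis by simp
  qed
  moreover have "fin_subspace hscale (khom.span (E ` (B \<times> C)))"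
    using B(2) C(2) by (intro khom.fin_subspace_span) auto
  ultimately show ?thesis using khom.fin_subspace_subset[OF _ subspace_mhom, of "khom.span (E ` (B \<times> C))"] by auto
qed

section \<open>Submodules, quotients and short exact sequences\<close>

lemma
  assumes "fd_module V a"
  shows carrier_Abs: "carrier (Abs_fdmod (V, a)) = V" and act_Abs: "act (Abs_fdmod (V, a)) = a"
  using assms by (simp_all add: carrier_def act_def Abs_fdmod_inverse)

definition submod where "submod M W = Abs_fdmod (W, act M)"

lemma
  assumes "kvec.subspace W" "W \<subseteq> carrier M" "\<And>v a. v \<in> W \<Longrightarrow> act M v a \<in> W"
  shows carrier_submod: "carrier (submod M W) = W" and act_submod: "act (submod M W) = act M"
proof -
  have "fin_subspace vscale W"
    using kvec.fin_subspace_subset[OF fin_subspace_carrier assms(1,2)] .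
  then have "fd_module W (act M)"
    using assms unfolding fd_module_def
    by (auto simp: fin_subspace_def subset_iff act_add_left act_scale_left act_add_right
        act_scale_right act_mult act_one)
  then show "carrier (submod M W) = W" "act (submod M W) = act M"
    by (simp_all add: submod_def carrier_Abs act_Abs)
qed

text \<open>Carriers consist of vectors, not cosets, so the quotient is realised on a linear
  complement \<open>V\<close> of \<open>W\<close>. With \<open>F\<close> the projection onto
  \<open>V\<close> along \<open>W\<close>, the algebra acts on \<open>V\<close> by its action in
  \<open>M\<close> followed by \<open>F\<close>.\<close>

lemma quotient_exists:
  fixes M :: "('x::{finite,order}, 'k::field) fdmod"
  assumes W: "kvec.subspace W" "W \<subseteq> carrier M" "\<And>v a. v \<in> W \<Longrightarrow> act M v a \<in> W"
  obtains Q :: "('x, 'k) fdmod" and p where "p \<in> mhom M Q" "p ` carrier M = carrier Q" "mker M p = W"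
proof -
  have "fin_subspace vscale W"
    using kvec.fin_subspace_subset[OF fin_subspace_carrier W(1,2)] .
  then obtain A where A: "kvec.independent A" "finite A" "W = kvec.span A"
    using kvec.fin_subspace_basis by blast
  have AW: "A \<subseteq> W" using A(3) kvec.span_superset by blast
  obtain B where B: "A \<subseteq> B" "kvec.independent B" "finite B" "carrier M = kvec.span B"
    using kvec.extend_basis_fin_subspace[OF fin_subspace_carrier _ A(1), of M] AW W(2) by blast
  obtain F where F: "Vector_Spaces.linear vscale vscale F"
      "\<And>b. b \<in> B \<Longrightarrow> F b = (if b \<in> A then 0 else b)"
    using kvec_pair.linear_independent_extend[OF B(2), of "\<lambda>b. if b \<in> A then 0 else b"] by auto
  interpret F: Vector_Spaces.linear vscale vscale F by (rule F(1))
  define V where "V = kvec.span (B - A)"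
  have VM: "V \<subseteq> carrier M" unfolding V_def B(4) by (rule kvec.span_mono) auto
  have FW: "F v = 0" if "v \<in> W" for v
    using that unfolding A(3) by (rule F.eq_0_on_span[rotated]) (use F(2) B(1) in auto)
  have FV: "F v = v" if "v \<in> V" for v
  proof -
    have "F v = id v"
      using that unfolding V_def
      by (rule kvec_pair.linear_eq_on[OF F(1) kvec.linear_id]) (use F(2) in auto)
    then show ?thesis by simp
  qed
  have dec: "\<exists>w u. w \<in> W \<and> u \<in> V \<and> v = w + u" if "v \<in> carrier M" for v
  proof -
    have "A \<union> (B - A) = B" using B(1) by auto
    then show ?thesis using that kvec.span_Un[of A "B - A"] unfolding B(4) A(3) V_def by auto
  qed
  have Fc: "F v \<in> V" and Fd: "v - F v \<in> W" if v: "v \<in> carrier M" for v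
  proof -
    obtain w u where wu: "w \<in> W" "u \<in> V" "v = w + u" using dec[OF v] by blast
    then show "F v \<in> V" "v - F v \<in> W" using FW FV by (auto simp: F.add)
  qed
  \<comment> \<open>\<open>V\<close> may fail to be a submodule, but \<open>v - F v\<close> lies in
    \<open>W\<close>, which the action preserves and \<open>F\<close> kills. This gives
    associativity of the new action as well as compatibility of the projection.\<close>
  have FF: "F (act M (F v) a) = F (act M v a)" if v: "v \<in> carrier M" for v a
  proof -
    have "act M v a = act M (v - F v) a + act M (F v) a"
      using act_add_left[of "v - F v" M "F v" a] Fc[OF v] Fd[OF v] VM W(2) by auto
    then show ?thesis using FW[OF W(3)[OF Fd[OF v]]] by (simp add: F.add)
  qed
  define Q where "Q = (Abs_fdmod (V, \<lambda>v a. F (act M v a)) :: ('x, 'k) fdmod)"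
  have VM': "v \<in> carrier M" if "v \<in> V" for v using VM that by auto
  have "fd_module V (\<lambda>v a. F (act M v a))"
    unfolding fd_module_def
  proof (intro conjI ballI allI)
    show "\<exists>B. finite B \<and> V = kvec.span B" using B(3) V_def by blast
  qed (auto simp: VM' Fc act_carrier act_add_left act_scale_left act_add_right act_scale_right
      act_mult act_one F.add F.scale FF FV)
  then have Q: "carrier Q = V" "act Q = (\<lambda>v a. F (act M v a))"
    by (simp_all add: Q_def carrier_Abs act_Abs)
  define p where "p = (\<lambda>v. if v \<in> carrier M then F v else 0)"
  show thesis
  proof
    show "p \<in> mhom M Q"
      by (rule mhomI) (auto simp: p_def Q Fc linear_on_def F.add F.scale FF add_carrier scale_carrier)
    show "p ` carrier M = carrier Q"
      using VM FV Fc by (force simp: p_def Q image_iff)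
    show "mker M p = W"
      using FW W(2) Fd unfolding mker_def p_def by fastforce
  qed
qed

lemma short_exactE:
  assumes "short_exact L M N"
  obtains f g where "f \<in> mhom L M" "g \<in> mhom M N" "inj_on f (carrier L)"
    "f ` carrier L = mker M g" "g ` carrier M = carrier N"
  using assms by (auto simp: short_exact_def)

text \<open>The idempotent at \<open>x\<close> projects a module onto its weight space and commutes
  with homomorphisms, so preimages of weight vectors can be corrected to weight vectors. Passing to
  weight spaces is thus exact, and rank-nullity applies.\<close>

lemma dimvec_short_exact:
  assumes "short_exact L M N"
  shows "dimvec M x = dimvec L x + dimvec N x"
proof -
  obtain f g where fg: "f \<in> mhom L M" "g \<in> mhom M N" "inj_on f (carrier L)"
    "f ` carrier L = mker M g" "g ` carrier M = carrier N" using short_exactE[OF assms] .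
  have "g ` weight_space M x = weight_space N x"
  proof
    show "weight_space N x \<subseteq> g ` weight_space M x"
    proof
      fix n assume n: "n \<in> weight_space N x"
      then obtain m where m: "m \<in> carrier M" "n = g m" using fg(5) by (auto simp: weight_space_def)
      then have "n = g (act M m (incalg_unit x x))"
        using n by (simp add: mhom_act[OF fg(2)] weight_space_def)
      then show "n \<in> g ` weight_space M x" using act_unit_weight_space[OF m(1)] by blast
    qed
  qed (use mhom_weight_space[OF fg(2)] in auto)
  moreover have "{v \<in> weight_space M x. g v = 0} = f ` weight_space L x"
  proof
    show "f ` weight_space L x \<subseteq> {v \<in> weight_space M x. g v = 0}"
      using mhom_weight_space[OF fg(1)] fg(4) weight_space_carrier unfolding mker_def by blast
    show "{v \<in> weight_space M x. g v = 0} \<subseteq> f ` weight_space L x"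
    proof clarify
      fix v assume v: "v \<in> weight_space M x" "g v = 0"
      then obtain l where l: "l \<in> carrier L" "v = f l"
        using fg(4) weight_space_carrier unfolding mker_def by blast
      then have "f (act L l (incalg_unit x x)) = v"
        using v by (simp add: mhom_act[OF fg(1)] weight_space_def)
      then show "v \<in> f ` weight_space L x" using act_unit_weight_space[OF l(1)] by blast
    qed
  qed
  moreover have "kvec.dim (f ` weight_space L x) = kvec.dim (weight_space L x)"
    by (rule kvec_pair.dim_inj_image[OF fin_subspace_weight_space linear_on_mhom_weight_space[OF fg(1)]])
      (rule inj_on_subset[OF fg(3)], auto simp: weight_space_def)
  ultimately show ?thesis
    using kvec_pair.rank_nullity[OF fin_subspace_weight_space linear_on_mhom_weight_space[OF fg(2)], of x]
    by (simp add: dimvec_def)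
qed

section \<open>Modules on convex index sets\<close>

text \<open>Carriers are made of functions on \<open>nat\<close>, so a coordinate labelled by a
  layer and a poset element needs a number; a chosen injection of the finite type supplies the
  second half of the code.\<close>

definition idx :: "nat \<times> 'x::finite \<Rightarrow> nat" where
  "idx p = prod_encode (fst p, (SOME h :: 'x \<Rightarrow> nat. inj h) (snd p))"

lemma idx_inject [simp]: "idx p = idx q \<longleftrightarrow> p = (q :: nat \<times> 'x::finite)"
proof -
  have "\<exists>h :: 'x \<Rightarrow> nat. inj h" using finite_imp_inj_to_nat_seg[of "UNIV :: 'x set"] by auto
  then have "inj (SOME h :: 'x \<Rightarrow> nat. inj h)" by (rule someI_ex)
  then show ?thesis by (simp add: idx_def prod_eq_iff inj_eq)
qed

definition tvec :: "(nat \<times> 'x::finite) set \<Rightarrow> (nat \<times> 'x \<Rightarrow> 'k::field) \<Rightarrow> 'k kvec" where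
  "tvec T h = (\<lambda>j. if j \<in> idx ` T then h (inv idx j) else 0)"

definition tbasis :: "(nat \<times> 'x::finite) set \<Rightarrow> nat \<times> 'x \<Rightarrow> 'k::field kvec" where
  "tbasis T p = tvec T (\<lambda>q. if q = p then 1 else 0)"

lemma tvec_idx [simp]: "tvec T h (idx p) = (if p \<in> T then h p else 0)"
proof -
  have "inj (idx :: nat \<times> 'b::finite \<Rightarrow> nat)" by (simp add: inj_def)
  then show ?thesis by (auto simp: tvec_def inv_f_f)
qed

lemma tbasis_idx [simp]: "tbasis T p (idx q) = (if q \<in> T \<and> q = p then 1 else 0)"
  by (auto simp: tbasis_def)

lemma tvec_eqI:
  assumes "v \<in> range (tvec T)" "w \<in> range (tvec T)" "\<And>p. p \<in> T \<Longrightarrow> v (idx p) = w (idx p)"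
  shows "v = w"
proof
  fix j
  show "v j = w j" using assms by (cases "j \<in> idx ` T") (auto simp: tvec_def)
qed

lemma range_tvec_zero: "v \<in> range (tvec T) \<Longrightarrow> p \<notin> T \<Longrightarrow> v (idx p) = 0"
  by auto

lemma tbasis_range [simp]: "tbasis T p \<in> range (tvec T)"
  by (simp add: tbasis_def)

lemma subspace_range_tvec: "kvec.subspace (range (tvec T) :: 'k::field kvec set)"
  unfolding kvec.subspace_def
proof (intro conjI ballI allI)
  show "(0 :: 'k kvec) \<in> range (tvec T)" by (rule range_eqI[of _ _ "\<lambda>_. 0"]) (auto simp: tvec_def fun_eq_iff)
  fix c and v w :: "'k kvec" assume "v \<in> range (tvec T)"
  then obtain h where v: "v = tvec T h" by blast
  show "vscale c v \<in> range (tvec T)"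
    by (rule range_eqI[of _ _ "\<lambda>p. c * h p"]) (auto simp: v tvec_def vscale_def fun_eq_iff)
  assume "w \<in> range (tvec T)"
  then obtain g where w: "w = tvec T g" by blast
  show "v + w \<in> range (tvec T)"
    by (rule range_eqI[of _ _ "\<lambda>p. h p + g p"]) (auto simp: v w tvec_def fun_eq_iff)
qed

lemma vscale_apply: "vscale c v i = c * v i"
  by (simp add: vscale_def)

lemma sum_fun_apply: "sum h I v = (\<Sum>i\<in>I. h i v)"
  for h :: "'i \<Rightarrow> 'y \<Rightarrow> 'z::comm_monoid_add"
  by (induction I rule: infinite_finite_induct) auto

lemma eq_sum_tbasis:
  assumes "finite T" "v \<in> range (tvec T)"
  shows "v = (\<Sum>p\<in>T. vscale (v (idx p)) (tbasis T p))"
proof (rule tvec_eqI[OF assms(2)])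
  show "(\<Sum>p\<in>T. vscale (v (idx p)) (tbasis T p)) \<in> range (tvec T)"
    by (intro kvec.subspace_sum[OF subspace_range_tvec] kvec.subspace_scale[OF subspace_range_tvec]) simp
  fix p assume p: "p \<in> T"
  have "(\<Sum>q\<in>T. vscale (v (idx q)) (tbasis T q) (idx p)) = (\<Sum>q\<in>T. if q = p then v (idx p) else 0)"
    using p by (intro sum.cong) (auto simp: vscale_def)
  then show "v (idx p) = (\<Sum>q\<in>T. vscale (v (idx q)) (tbasis T q)) (idx p)"
    using p assms(1) by (simp add: sum_fun_apply)
qed

definition tact :: "(nat \<times> 'x::{finite,order}) set \<Rightarrow> 'k::field kvec \<Rightarrow> ('x, 'k) incalg \<Rightarrow> 'k kvec" where
  "tact T v a = tvec T (\<lambda>(l, z). \<Sum>u\<in>UNIV. v (idx (l, u)) * coeff a u z)"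

text \<open>The index set \<open>T\<close> is cut into layers by its first component, and each layer spans a module
  if it is convex in the poset. The upper set of \<open>x\<close> gives the projective cover of the simple module
  at \<open>x\<close>, the lower set its injective hull.\<close>

definition tconvex :: "(nat \<times> 'x::{finite,order}) set \<Rightarrow> bool" where
  "tconvex T \<longleftrightarrow> (\<forall>l u z w. (l, u) \<in> T \<longrightarrow> (l, w) \<in> T \<longrightarrow> u \<le> z \<longrightarrow> z \<le> w \<longrightarrow> (l, z) \<in> T)"

definition tmod :: "(nat \<times> 'x::{finite,order}) set \<Rightarrow> ('x, 'k::field) fdmod" where
  "tmod T = Abs_fdmod (range (tvec T), tact T)"

lemma fd_module_tmod:
  fixes T :: "(nat \<times> 'x::{finite,order}) set"
  assumes "finite T" "tconvex T"
  shows "fd_module (range (tvec T)) (tact T :: 'k::field kvec \<Rightarrow> _)"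
  unfolding fd_module_def
proof (intro conjI ballI allI)
  note S = subspace_range_tvec[of T, where 'k='k]
  have "range (tvec T) = kvec.span (tbasis T ` T :: 'k kvec set)"
  proof
    show "kvec.span (tbasis T ` T :: 'k kvec set) \<subseteq> range (tvec T)"
      by (rule kvec.span_minimal[OF _ S]) auto
    show "range (tvec T) \<subseteq> kvec.span (tbasis T ` T :: 'k kvec set)"
    proof
      fix v :: "'k kvec" assume "v \<in> range (tvec T)"
      from eq_sum_tbasis[OF assms(1) this] show "v \<in> kvec.span (tbasis T ` T)"
        by (metis (no_types, lifting) image_eqI kvec.span_base kvec.span_scale kvec.span_sum)
    qed
  qed
  then show "\<exists>B. finite B \<and> range (tvec T) = (kvec.span B :: 'k kvec set)" using assms(1) by blast
  fix v :: "'k kvec" and a :: "('x, 'k) incalg" assume v: "v \<in> range (tvec T)"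
  have R: "tact T w b \<in> range (tvec T)" for w b by (simp add: tact_def)
  show "tact T v a \<in> range (tvec T)" by (rule R)
  show "tact T v 1 = v"
    by (rule tvec_eqI[OF R v]) (auto simp: tact_def one_incalg.rep_eq if_distrib[of "\<lambda>t. _ * t"] cong: if_cong)
  fix c
  show "tact T (vscale c v) a = vscale c (tact T v a)"
    by (rule tvec_eqI[OF R kvec.subspace_scale[OF S R]])
      (auto simp: tact_def vscale_def sum_distrib_left mult.assoc)
  show "tact T v (incalg_scale c a) = vscale c (tact T v a)"
    by (rule tvec_eqI[OF R kvec.subspace_scale[OF S R]])
      (auto simp: tact_def vscale_def sum_distrib_left incalg_scale.rep_eq algebra_simps)
  fix b :: "('x, 'k) incalg"
  show "tact T v (a + b) = tact T v a + tact T v b"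
    by (rule tvec_eqI[OF R kvec.subspace_add[OF S R R]])
      (auto simp: tact_def plus_incalg.rep_eq algebra_simps sum.distrib)
  show "tact T v (a * b) = tact T (tact T v a) b"
  proof (rule tvec_eqI[OF R R])
    fix p assume p: "p \<in> T"
    obtain l w where lw: "p = (l, w)" by (cases p)
    have "tact T v (a * b) (idx p) =
        (\<Sum>u\<in>UNIV. \<Sum>z\<in>UNIV. v (idx (l, u)) * coeff a u z * coeff b z w)"
      using p by (simp add: tact_def lw times_incalg.rep_eq sum_distrib_left mult.assoc)
    also have "\<dots> = (\<Sum>u\<in>UNIV. \<Sum>z\<in>UNIV. (if (l, z) \<in> T then v (idx (l, u)) * coeff a u z else 0) * coeff b z w)"
    proof (intro sum.cong refl)
      fix u z
      \<comment> \<open>A nonzero term has both \<open>(l, u)\<close> and \<open>(l, w)\<close> in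
        \<open>T\<close> with \<open>u \<le> z\<close> and \<open>z \<le> w\<close>, so convexity
        keeps the intermediate index. Discarding entries between the two actions therefore loses
        nothing.\<close>
      have "(l, z) \<in> T" if ne: "v (idx (l, u)) * coeff a u z * coeff b z w \<noteq> 0"
      proof -
        from ne have "v (idx (l, u)) \<noteq> 0" "coeff a u z \<noteq> 0" "coeff b z w \<noteq> 0" by auto
        then have "(l, u) \<in> T" "u \<le> z" "z \<le> w"
          using range_tvec_zero[OF v, of "(l, u)"] coeff_eq_0[of u z a] coeff_eq_0[of z w b] by auto
        then show ?thesis using assms(2) p unfolding lw tconvex_def by blast
      qed
      then show "v (idx (l, u)) * coeff a u z * coeff b z w =
          (if (l, z) \<in> T then v (idx (l, u)) * coeff a u z else 0) * coeff b z w"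
        by auto
    qed
    also have "\<dots> = (\<Sum>z\<in>UNIV. \<Sum>u\<in>UNIV. (if (l, z) \<in> T then v (idx (l, u)) * coeff a u z else 0) * coeff b z w)"
      by (rule sum.swap)
    also have "\<dots> = tact T (tact T v a) b (idx p)"
      using p by (auto simp: tact_def lw sum_distrib_right intro!: sum.cong)
    finally show "tact T v (a * b) (idx p) = tact T (tact T v a) b (idx p)" .
  qed
  fix w :: "'k kvec"
  show "tact T (v + w) a = tact T v a + tact T w a"
    by (rule tvec_eqI[OF R kvec.subspace_add[OF S R R]])
      (auto simp: tact_def algebra_simps sum.distrib)
qed

lemma
  assumes "finite T" "tconvex T"
  shows carrier_tmod: "carrier (tmod T) = range (tvec T)" and act_tmod: "act (tmod T) = tact T"
  unfolding tmod_def by (rule carrier_Abs[OF fd_module_tmod[OF assms]], rule act_Abs[OF fd_module_tmod[OF assms]])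

lemma tact_idx: "tact T v a (idx (l, z)) = (if (l, z) \<in> T then \<Sum>u\<in>UNIV. v (idx (l, u)) * coeff a u z else 0)"
  by (simp add: tact_def)

lemma tact_unit_idx:
  "tact T (v :: 'k::field kvec) (incalg_unit x (y :: 'x::{finite,order})) (idx (l, z)) = (if (l, z) \<in> T \<and> x \<le> y \<and> z = y then v (idx (l, x)) else 0)"
proof -
  have "(\<Sum>u\<in>UNIV. v (idx (l, u)) * coeff (incalg_unit x y :: ('x, 'k) incalg) u z) =
      (\<Sum>u\<in>UNIV. if u = x then (if x \<le> y \<and> z = y then v (idx (l, x)) else 0) else 0)"
    by (intro sum.cong) (auto simp: coeff_unit)
  then show ?thesis unfolding tact_idx by auto
qed

section \<open>Simple modules and induction on the length\<close>

lemma simple_carrier_eq: "{v :: 'k::field kvec. \<forall>i>0. v i = 0} = range (\<lambda>c. vscale c (\<lambda>i. if i = 0 then 1 else 0))"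
proof -
  have "v = vscale (v 0) (\<lambda>i. if i = 0 then 1 else 0)" if "\<forall>i>0. v i = 0" for v :: "'k kvec"
    using that by (auto simp: vscale_def fun_eq_iff)
  then show ?thesis by (auto simp: vscale_def)
qed

lemma dimvec_simple: "dimvec (simple_module x :: ('x::{finite,order}, 'k::field) fdmod) z = (if z = x then 1 else 0)"
proof (cases "z = x")
  case True
  have ne: "(\<lambda>i::nat. if i = 0 then 1 else 0 :: 'k) \<noteq> 0"
    by (auto simp: fun_eq_iff intro!: exI[of _ 0])
  have "weight_space (simple_module x :: ('x, 'k) fdmod) x = {v. \<forall>i>0. v i = 0}"
    by (auto simp: weight_space_def coeff_unit vscale_def)
  then show ?thesis using True kvec.dim_line[OF ne] by (simp add: dimvec_def simple_carrier_eq)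
next
  case False
  have "weight_space (simple_module x :: ('x, 'k) fdmod) z = {0}"
    using False by (auto simp: weight_space_def coeff_unit vscale_def)
  then show ?thesis using False by (simp add: dimvec_def)
qed

lemma short_exact_simple_exists:
  fixes N :: "('x::{finite,order}, 'k::field) fdmod"
  assumes v: "v \<in> carrier N" "v \<noteq> 0" "\<And>a. act N v a = vscale (coeff a x x) v"
  obtains Q where "short_exact (simple_module x) N Q"
proof -
  let ?W = "range (\<lambda>c. vscale c v)"
  have W: "kvec.subspace ?W" by (metis kvec.span_singleton kvec.subspace_span)
  have WN: "?W \<subseteq> carrier N" using v(1) by auto
  have Wa: "act N w a \<in> ?W" if "w \<in> ?W" for w a
    using that v by (auto simp: act_scale_left kvec.scale_scale)
  obtain Q p where Q: "p \<in> mhom N Q" "p ` carrier N = carrier Q" "mker N p = ?W"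
    by (rule quotient_exists[OF W WN Wa])
  define f where "f = (\<lambda>u :: 'k kvec. if \<forall>i>0. u i = 0 then vscale (u 0) v else 0)"
  have "f \<in> mhom (simple_module x) N"
    by (rule mhomI) (auto simp: f_def linear_on_def kvec.scale_left_distrib v act_scale_left scale_carrier,
      auto simp: vscale_def mult_ac)
  moreover have "inj_on f (carrier (simple_module x :: ('x, 'k) fdmod))"
  proof (rule inj_onI)
    fix u w assume a: "u \<in> carrier (simple_module x :: ('x, 'k) fdmod)"
      "w \<in> carrier (simple_module x :: ('x, 'k) fdmod)" "f u = f w"
    then have "u 0 = w 0" using v(2) by (simp add: f_def)
    show "u = w"
    proof
      fix i show "u i = w i" using a \<open>u 0 = w 0\<close> by (cases "i = 0") auto
    qed
  qed
  moreover have "f ` carrier (simple_module x :: ('x, 'k) fdmod) = ?W"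
  proof -
    have "f (vscale c (\<lambda>i. if i = 0 then 1 else 0)) = vscale c v" for c
      by (simp add: f_def vscale_def)
    then show ?thesis unfolding carrier_simple_module simple_carrier_eq by (simp add: image_image)
  qed
  ultimately show thesis using that[of Q] Q unfolding short_exact_def by metis
qed

text \<open>Induction on the total dimension. At a maximal element \<open>x\<close> of the support,
  a nonzero weight vector is killed by the units from \<open>x\<close> to other elements, hence
  spans a copy of the simple module, and the quotient is smaller by one. This rule takes the place
  of composition series in the later additivity arguments.\<close>

lemma fdmod_induct [case_names zero step]:
  fixes N :: "('x::{finite,order}, 'k::field) fdmod"
  assumes zero: "\<And>N :: ('x, 'k) fdmod. carrier N = {0} \<Longrightarrow> P N"
    and step: "\<And>x N (Q :: ('x, 'k) fdmod). short_exact (simple_module x) N Q \<Longrightarrow> P Q \<Longrightarrow> P N"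
  shows "P N"
proof (induction "\<Sum>x\<in>UNIV. dimvec N x" arbitrary: N rule: less_induct)
  case less
  show ?case
  proof (cases "\<exists>x. dimvec N x \<noteq> 0")
    case False
    then have "v = 0" if "v \<in> carrier N" for v
      using eq_sum_act_unit[OF that] act_unit_weight_space[OF that] dimvec_eq_0_iff[of N] by simp
    then show ?thesis using zero zero_carrier by blast
  next
    case True
    then obtain x where x: "dimvec N x \<noteq> 0" "\<And>y. dimvec N y \<noteq> 0 \<Longrightarrow> x \<le> y \<Longrightarrow> y = x"
      using finite_has_maximal[of "{x. dimvec N x \<noteq> 0}"] by auto
    have "weight_space N x \<noteq> {0}" "0 \<in> weight_space N x"
      using x(1) kvec.subspace_0[OF subspace_weight_space] by (simp_all add: dimvec_eq_0_iff)
    then obtain v where v: "v \<in> weight_space N x" "v \<noteq> 0" by auto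
    have vN: "v \<in> carrier N" using v(1) by (simp add: weight_space_def)
    have "act N v (incalg_unit x y) = 0" if "y \<noteq> x" for y
    proof (cases "x \<le> y")
      case True
      then have "weight_space N y = {0}" using x(2)[of y] that dimvec_eq_0_iff[of N y] by auto
      then show ?thesis using act_unit_weight_space[OF vN, of x y] by simp
    qed (simp add: incalg_unit_eq_0 vN)
    moreover have "act N v (incalg_unit x x) = v" using v(1) by (simp add: weight_space_def)
    ultimately have "vscale (coeff a x y) (act N v (incalg_unit x y)) =
        (if y = x then vscale (coeff a x x) v else 0)" for a y
      by simp
    then have "act N v a = vscale (coeff a x x) v" for a
      using act_weight_space[OF v(1), of a] by simp
    then obtain Q where Q: "short_exact (simple_module x) N Q"
      by (rule short_exact_simple_exists[OF vN v(2)])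
    have "(\<Sum>y\<in>UNIV. dimvec N y) = 1 + (\<Sum>y\<in>UNIV. dimvec Q y)"
      using dimvec_short_exact[OF Q] by (simp add: sum.distrib dimvec_simple)
    then show ?thesis using less step[OF Q] by simp
  qed
qed

section \<open>Projective modules\<close>

text \<open>Layer \<open>l\<close> carries the projective cover of the simple module at
  \<open>xs l\<close>, so the resulting module is a direct sum of \<open>m\<close> such covers, with
  repetitions allowed.\<close>

definition proj_set :: "nat \<Rightarrow> (nat \<Rightarrow> 'x::order) \<Rightarrow> (nat \<times> 'x) set" where
  "proj_set m xs = {(l, y). l < m \<and> xs l \<le> y}"

definition proj_mod :: "nat \<Rightarrow> (nat \<Rightarrow> 'x::{finite,order}) \<Rightarrow> ('x, 'k::field) fdmod" where
  "proj_mod m xs = tmod (proj_set m xs)"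

lemma proj_set: "finite (proj_set m (xs :: nat \<Rightarrow> 'x::{finite,order}))" "tconvex (proj_set m xs)"
proof -
  show "finite (proj_set m xs)"
    by (rule finite_subset[of _ "{..<m} \<times> UNIV"]) (auto simp: proj_set_def)
  show "tconvex (proj_set m xs)" by (auto simp: proj_set_def tconvex_def intro: order_trans)
qed

lemmas carrier_proj_mod = carrier_tmod[OF proj_set, folded proj_mod_def]
  and act_proj_mod = act_tmod[OF proj_set, folded proj_mod_def]

text \<open>The basis vector \<open>(l, y)\<close> goes to \<open>n l\<close> moved from
  \<open>xs l\<close> to \<open>y\<close>. As the units start at \<open>xs l\<close>, only the
  component of \<open>n l\<close> at \<open>xs l\<close> enters, so arbitrary preimages may be used
  as \<open>n l\<close>.\<close>

definition proj_hom :: "nat \<Rightarrow> (nat \<Rightarrow> 'x::{finite,order}) \<Rightarrow> ('x, 'k::field) fdmod \<Rightarrow> (nat \<Rightarrow> 'k kvec) \<Rightarrow> 'k kvec \<Rightarrow> 'k kvec" where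
  "proj_hom m xs N n v = (if v \<in> range (tvec (proj_set m xs)) then
     \<Sum>l<m. \<Sum>y\<in>UNIV. vscale (v (idx (l, y))) (act N (n l) (incalg_unit (xs l) y)) else 0)"

lemma proj_hom:
  fixes N :: "('x::{finite,order}, 'k::field) fdmod"
  assumes n: "\<And>l. l < m \<Longrightarrow> n l \<in> carrier N"
  shows "proj_hom m xs N n \<in> mhom (proj_mod m xs) N"
proof (rule mhomI)
  let ?T = "proj_set m xs"
  let ?P = "proj_mod m xs :: ('x, 'k) fdmod"
  have zero: "act N (n l) (incalg_unit (xs l) y) = 0" if "l < m" "\<not> xs l \<le> y" for l y
    using that n by (simp add: incalg_unit_eq_0)
  show "v \<notin> carrier ?P \<Longrightarrow> proj_hom m xs N n v = 0" for v
    by (simp add: proj_hom_def carrier_proj_mod)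
  show "v \<in> carrier ?P \<Longrightarrow> proj_hom m xs N n v \<in> carrier N" for v
    by (auto simp: proj_hom_def intro!: sum_carrier scale_carrier act_carrier n)
  show "linear_on vscale vscale (carrier ?P) (proj_hom m xs N n)"
    unfolding linear_on_def carrier_proj_mod
  proof (intro conjI ballI allI)
    fix v :: "'k kvec" and c assume v: "v \<in> range (tvec ?T)"
    then show "proj_hom m xs N n (vscale c v) = vscale c (proj_hom m xs N n v)"
      using kvec.subspace_scale[OF subspace_range_tvec v, of c]
      by (simp add: proj_hom_def kvec.scale_sum_right vscale_apply del: image_iff)
    fix w :: "'k kvec" assume w: "w \<in> range (tvec ?T)"
    show "proj_hom m xs N n (v + w) = proj_hom m xs N n v + proj_hom m xs N n w"
      using v w kvec.subspace_add[OF subspace_range_tvec v w]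
      by (simp add: proj_hom_def kvec.scale_left_distrib sum.distrib del: image_iff)
  qed
  fix v and a :: "('x, 'k) incalg" assume v: "v \<in> carrier ?P"
  have "proj_hom m xs N n (act ?P v a) = (\<Sum>l<m. \<Sum>y\<in>UNIV.
      vscale (\<Sum>u\<in>UNIV. v (idx (l, u)) * coeff a u y) (act N (n l) (incalg_unit (xs l) y)))"
    using act_carrier[OF v] unfolding proj_hom_def carrier_proj_mod
    by (auto intro!: sum.cong simp: act_proj_mod tact_idx proj_set_def zero)
  also have "\<dots> = (\<Sum>l<m. \<Sum>y\<in>UNIV. \<Sum>u\<in>UNIV.
      vscale (v (idx (l, u))) (vscale (coeff a u y) (act N (n l) (incalg_unit (xs l) y))))"
    by (simp add: kvec.scale_sum_left)
  also have "\<dots> = (\<Sum>l<m. \<Sum>u\<in>UNIV. \<Sum>y\<in>UNIV.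
      vscale (v (idx (l, u))) (vscale (coeff a u y) (act N (n l) (incalg_unit (xs l) y))))"
    by (intro sum.cong refl sum.swap)
  also have "\<dots> = (\<Sum>l<m. \<Sum>u\<in>UNIV.
      vscale (v (idx (l, u))) (act N (act N (n l) (incalg_unit (xs l) u)) a))"
  proof (intro sum.cong refl)
    fix l u assume l: "l \<in> {..<m}"
    show "(\<Sum>y\<in>UNIV. vscale (v (idx (l, u))) (vscale (coeff a u y) (act N (n l) (incalg_unit (xs l) y)))) =
      vscale (v (idx (l, u))) (act N (act N (n l) (incalg_unit (xs l) u)) a)"
    proof (cases "xs l \<le> u")
      case True
      then show ?thesis
        using l n by (simp add: act_unit_act kvec.scale_sum_right del: kvec.scale_scale)
    next
      case False
      then have "v (idx (l, u)) = 0"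
        using v by (auto simp: carrier_proj_mod proj_set_def)
      then show ?thesis by simp
    qed
  qed
  also have "\<dots> = act N (proj_hom m xs N n v) a"
  proof -
    let ?t = "\<lambda>l u. vscale (v (idx (l, u))) (act N (n l) (incalg_unit (xs l) u))"
    have t: "?t l u \<in> carrier N" if "l < m" for l u
      using n[OF that] by (intro scale_carrier act_carrier)
    have "act N (proj_hom m xs N n v) a = act N (\<Sum>l<m. \<Sum>u\<in>UNIV. ?t l u) a"
      using v unfolding proj_hom_def carrier_proj_mod by simp
    also have "\<dots> = (\<Sum>l<m. act N (\<Sum>u\<in>UNIV. ?t l u) a)"
      by (rule act_sum_left) (use t in \<open>auto intro!: sum_carrier\<close>)
    also have "\<dots> = (\<Sum>l<m. \<Sum>u\<in>UNIV. act N (?t l u) a)"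
      by (intro sum.cong refl act_sum_left) (use t in auto)
    also have "\<dots> = (\<Sum>l<m. \<Sum>u\<in>UNIV.
        vscale (v (idx (l, u))) (act N (act N (n l) (incalg_unit (xs l) u)) a))"
      using n by (intro sum.cong refl act_scale_left) auto
    finally show ?thesis by simp
  qed
  finally show "proj_hom m xs N n (act ?P v a) = act N (proj_hom m xs N n v) a" .
qed

lemma proj_hom_cong: "(\<And>l. l < m \<Longrightarrow> n l = n' l) \<Longrightarrow> proj_hom m xs N n = proj_hom m xs N n'"
  by (rule ext) (auto simp: proj_hom_def intro!: sum.cong)

definition proj_gen :: "nat \<Rightarrow> (nat \<Rightarrow> 'x::{finite,order}) \<Rightarrow> nat \<Rightarrow> 'k::field kvec" where
  "proj_gen m xs l = tbasis (proj_set m xs) (l, xs l)"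

lemma proj_gen_carrier: "proj_gen m xs l \<in> carrier (proj_mod m xs)"
  by (simp add: proj_gen_def carrier_proj_mod)

lemma proj_hom_gen:
  assumes "l < m"
  shows "proj_hom m xs N n (proj_gen m xs l) = act N (n l) (incalg_unit (xs l) (xs l))"
proof -
  have "proj_hom m xs N n (proj_gen m xs l) = (\<Sum>k<m. \<Sum>y\<in>UNIV.
      if k = l then (if y = xs l then act N (n l) (incalg_unit (xs l) (xs l)) else 0) else 0)"
    unfolding proj_hom_def proj_gen_def
    using assms by (auto intro!: sum.cong simp: proj_set_def)
  also have "\<dots> = (\<Sum>k<m. if k = l then act N (n l) (incalg_unit (xs l) (xs l)) else 0)"
    by (intro sum.cong) auto
  finally show ?thesis using assms by simp
qed

text \<open>Every basis vector \<open>(l, y)\<close> arises from the generator of layer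
  \<open>l\<close> by the unit from \<open>xs l\<close> to \<open>y\<close>, so the values on the
  generators determine everything.\<close>

lemma mhom_proj_mod_eq:
  fixes N :: "('x::{finite,order}, 'k::field) fdmod"
  assumes f: "f \<in> mhom (proj_mod m xs) N"
  shows "f = proj_hom m xs N (\<lambda>l. f (proj_gen m xs l))"
proof (rule mhom_eqI[OF f proj_hom])
  let ?T = "proj_set m xs"
  show "f (proj_gen m xs l) \<in> carrier N" for l by (rule mhom_carrier'[OF f])
  fix v assume v: "v \<in> carrier (proj_mod m xs :: ('x, 'k) fdmod)"
  have gen: "act N (f (proj_gen m xs l)) (incalg_unit (xs l) y) = f (tbasis ?T (l, y))" if "(l, y) \<in> ?T" for l y
  proof -
    have "act (proj_mod m xs) (proj_gen m xs l) (incalg_unit (xs l) y) = (tbasis ?T (l, y) :: 'k kvec)"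
      unfolding act_proj_mod proj_gen_def
    proof (rule tvec_eqI[of _ ?T])
      fix p :: "nat \<times> 'x" assume "p \<in> ?T"
      then show "tact ?T (tbasis ?T (l, xs l)) (incalg_unit (xs l) y) (idx p) = (tbasis ?T (l, y) :: 'k kvec) (idx p)"
        using that by (cases p) (auto simp: tact_unit_idx proj_set_def)
    qed (simp_all add: tact_def)
    then show ?thesis by (simp add: mhom_act[OF f proj_gen_carrier, symmetric])
  qed
  have "f v = f (\<Sum>p\<in>?T. vscale (v (idx p)) (tbasis ?T p))"
    by (rule arg_cong[of _ _ f], rule eq_sum_tbasis[OF proj_set(1)]) (use v in \<open>simp add: carrier_proj_mod\<close>)
  also have "\<dots> = (\<Sum>p\<in>?T. f (vscale (v (idx p)) (tbasis ?T p)))"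
    by (rule mhom_sum[OF f], rule scale_carrier) (simp add: carrier_proj_mod)
  also have "\<dots> = (\<Sum>p\<in>?T. vscale (v (idx p)) (f (tbasis ?T p)))"
    by (intro sum.cong refl mhom_scale[OF f]) (simp add: carrier_proj_mod)
  also have "\<dots> = (\<Sum>(l, y)\<in>?T. vscale (v (idx (l, y))) (act N (f (proj_gen m xs l)) (incalg_unit (xs l) y)))"
    by (intro sum.cong refl) (auto simp: gen)
  also have "\<dots> = (\<Sum>(l, y)\<in>{..<m} \<times> UNIV. vscale (v (idx (l, y))) (act N (f (proj_gen m xs l)) (incalg_unit (xs l) y)))"
    using v by (intro sum.mono_neutral_left) (auto simp: proj_set_def carrier_proj_mod)
  also have "\<dots> = proj_hom m xs N (\<lambda>l. f (proj_gen m xs l)) v"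
    using v by (simp add: proj_hom_def carrier_proj_mod sum.cartesian_product)
  finally show "f v = proj_hom m xs N (\<lambda>l. f (proj_gen m xs l)) v" .
qed

lemma proj_gen_weight:
  "proj_gen m xs l \<in> weight_space (proj_mod m xs :: ('x::{finite,order}, 'k::field) fdmod) (xs l)"
  unfolding weight_space_def
proof (intro CollectI conjI proj_gen_carrier)
  show "act (proj_mod m xs) (proj_gen m xs l) (incalg_unit (xs l) (xs l)) = (proj_gen m xs l :: 'k kvec)"
    unfolding act_proj_mod proj_gen_def
  proof (rule tvec_eqI[of _ "proj_set m xs"])
    fix p assume "p \<in> proj_set m xs"
    then show "tact (proj_set m xs) (tbasis (proj_set m xs) (l, xs l)) (incalg_unit (xs l) (xs l)) (idx p) =
        (tbasis (proj_set m xs) (l, xs l) :: 'k kvec) (idx p)"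
      by (cases p) (auto simp: tact_unit_idx)
  qed (simp_all add: tact_def)
qed

lemma projective_proj_mod: "projective (proj_mod m xs :: ('x::{finite,order}, 'k::field) fdmod)"
  unfolding projective_def
proof (intro allI ballI impI)
  fix M N :: "('x, 'k) fdmod" and g f
  assume g: "g \<in> mhom M N" and f: "f \<in> mhom (proj_mod m xs) N" and surj: "g ` carrier M = carrier N"
  have "\<exists>u\<in>carrier M. g u = f (proj_gen m xs l)" for l
    using surj mhom_carrier'[OF f, of "proj_gen m xs l"] by (metis imageE)
  then obtain n where n: "\<And>l. n l \<in> carrier M" "\<And>l. g (n l) = f (proj_gen m xs l)" by metis
  define h where "h = proj_hom m xs M n"
  have h: "h \<in> mhom (proj_mod m xs) M" unfolding h_def by (rule proj_hom) (rule n)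
  have gh: "g \<circ> h \<in> mhom (proj_mod m xs) N" by (rule mhom_compose[OF g h])
  \<comment> \<open>The preimage \<open>n l\<close> may have components of other weights; the unit
    at \<open>xs l\<close> removes them, and it fixes \<open>f (proj_gen m xs l)\<close> because
    homomorphisms preserve weights.\<close>
  have "(g \<circ> h) (proj_gen m xs l) = f (proj_gen m xs l)" if "l < m" for l
    using mhom_weight_space[OF f proj_gen_weight, of l] that
    by (simp add: h_def proj_hom_gen mhom_act[OF g] n weight_space_def)
  then have "proj_hom m xs N (\<lambda>l. (g \<circ> h) (proj_gen m xs l)) = proj_hom m xs N (\<lambda>l. f (proj_gen m xs l))"
    by (rule proj_hom_cong)
  then have "g \<circ> h = f" using mhom_proj_mod_eq[OF gh] mhom_proj_mod_eq[OF f] by simp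
  then show "\<exists>h\<in>mhom (proj_mod m xs) M. g \<circ> h = f" using h by blast
qed

text \<open>One layer is taken for each spanning vector \<open>b\<close> and each poset element
  \<open>x\<close>; its generator is mapped to the component of \<open>b\<close> at
  \<open>x\<close>. These components add up to \<open>b\<close>.\<close>

lemma enough_projectives:
  fixes M :: "('x::{finite,order}, 'k::field) fdmod"
  obtains P e where "projective P" "e \<in> mhom P M" "e ` carrier P = carrier M"
proof -
  obtain B where B: "finite B" "carrier M = kvec.span B"
    using fin_subspace_carrier[of M] by (auto simp: fin_subspace_def)
  have BM: "b \<in> carrier M" if "b \<in> B" for b using B(2) that kvec.span_base by auto
  obtain qs where qs: "set qs = B \<times> (UNIV :: 'x set)"
    using finite_list[of "B \<times> (UNIV :: 'x set)"] B(1) by auto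
  define m where "m = length qs"
  define xs where "xs = (\<lambda>l. snd (qs ! l))"
  define n where "n = (\<lambda>l. fst (qs ! l))"
  have n: "n l \<in> carrier M" if "l < m" for l
    using that qs BM nth_mem[of l qs] by (auto simp: n_def m_def mem_Times_iff)
  define e where "e = proj_hom m xs M n"
  have e: "e \<in> mhom (proj_mod m xs) M" unfolding e_def by (rule proj_hom) (rule n)
  have sub: "kvec.subspace (e ` carrier (proj_mod m xs :: ('x, 'k) fdmod))"
    by (rule kvec_pair.subspace_linear_on_image[OF subspace_carrier linear_on_mhom[OF e]])
  have "act M b (incalg_unit x x) \<in> e ` carrier (proj_mod m xs :: ('x, 'k) fdmod)" if "b \<in> B" for b x
  proof -
    have "(b, x) \<in> set qs" using that qs by simp
    then obtain l where l: "l < m" "qs ! l = (b, x)" unfolding m_def in_set_conv_nth by blast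
    then have "xs l = x" "n l = b" by (simp_all add: xs_def n_def)
    then have "act M b (incalg_unit x x) = e (proj_gen m xs l)"
      using proj_hom_gen[OF l(1), of xs M n] by (simp add: e_def)
    then show ?thesis using proj_gen_carrier by (rule image_eqI)
  qed
  then have "b \<in> e ` carrier (proj_mod m xs :: ('x, 'k) fdmod)" if "b \<in> B" for b
    using that by (subst eq_sum_act_unit[OF BM[OF that]]) (auto intro: kvec.subspace_sum[OF sub])
  then have "carrier M \<subseteq> e ` carrier (proj_mod m xs :: ('x, 'k) fdmod)"
    unfolding B(2) by (intro kvec.span_minimal[OF _ sub]) auto
  then have "e ` carrier (proj_mod m xs :: ('x, 'k) fdmod) = carrier M" using mhom_carrier[OF e] by auto
  then show thesis using that[OF projective_proj_mod e] by blast
qed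

text \<open>The modules \<open>K i\<close> are the successive syzygies, each covered by a chosen
  projective; the differentials are the covers of the next syzygy.\<close>

lemma projective_resolution_exists:
  fixes M :: "('x::{finite,order}, 'k::field) fdmod"
  shows "\<exists>P d e. projective_resolution M P d e"
proof -
  define cover :: "('x, 'k) fdmod \<Rightarrow> ('x, 'k) fdmod \<times> ('k kvec \<Rightarrow> 'k kvec) \<Rightarrow> bool" where
    "cover N q \<longleftrightarrow> projective (fst q) \<and> snd q \<in> mhom (fst q) N \<and> snd q ` carrier (fst q) = carrier N" for N q
  have "\<exists>q. cover N q" for N
  proof (rule enough_projectives[of N])
    fix P e assume "projective P" "e \<in> mhom P N" "e ` carrier P = carrier N"
    then show ?thesis by (intro exI[of _ "(P, e)"]) (simp add: cover_def)
  qed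
  then have "cover N (SOME q. cover N q)" for N by (rule someI_ex)
  moreover define Pc where "Pc = (\<lambda>N. fst (SOME q. cover N q))"
  moreover define ec where "ec = (\<lambda>N. snd (SOME q. cover N q))"
  ultimately have Pe: "projective (Pc N)" "ec N \<in> mhom (Pc N) N" "ec N ` carrier (Pc N) = carrier N" for N
    by (simp_all add: cover_def)
  define K where "K = rec_nat M (\<lambda>_ N. submod (Pc N) (mker (Pc N) (ec N)))"
  have K: "K 0 = M" "K (Suc i) = submod (Pc (K i)) (mker (Pc (K i)) (ec (K i)))" for i
    by (simp_all add: K_def)
  have KS: "carrier (K (Suc i)) = mker (Pc (K i)) (ec (K i))" "act (K (Suc i)) = act (Pc (K i))" for i
    unfolding K(2)
    using carrier_submod[OF subspace_mker[OF Pe(2)] _ act_mker[OF Pe(2)]]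
      act_submod[OF subspace_mker[OF Pe(2)] _ act_mker[OF Pe(2)]]
    by (auto simp: mker_def)
  \<comment> \<open>A syzygy is a subset of the previous projective with the same action, so its
    cover serves as the differential without composing with an inclusion.\<close>
  have "ec (K (Suc i)) \<in> mhom (Pc (K (Suc i))) (Pc (K i))" for i
    using Pe(2)[of "K (Suc i)"] KS[of i] by (auto simp: mhom_def mker_def)
  then have "projective_resolution M (\<lambda>i. Pc (K i)) (\<lambda>i. ec (K (Suc i))) (ec M)"
    unfolding projective_resolution_def using Pe K(1) KS by auto
  then show ?thesis by blast
qed

section \<open>Injective modules\<close>

definition inj_mod :: "'x::{finite,order} \<Rightarrow> ('x, 'k::field) fdmod" where
  "inj_mod y = tmod ({0} \<times> {..y})"

lemma inj_set: "finite ({0::nat} \<times> {..y :: 'x::{finite,order}})" "tconvex ({0} \<times> {..y})"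
  by (auto simp: tconvex_def)

lemmas carrier_inj_mod = carrier_tmod[OF inj_set, folded inj_mod_def]
  and act_inj_mod = act_tmod[OF inj_set, folded inj_mod_def]

lemma dimvec_inj_mod:
  "dimvec (inj_mod y :: ('x::{finite,order}, 'k::field) fdmod) x = (if x \<le> y then 1 else 0)"
proof -
  let ?T = "{0::nat} \<times> {..y}"
  let ?b = "tbasis ?T (0, x) :: 'k kvec"
  have ws: "weight_space (inj_mod y :: ('x, 'k) fdmod) x = {v \<in> range (tvec ?T). \<forall>z. z \<noteq> x \<longrightarrow> v (idx (0, z)) = 0}"
    (is "?L = ?R")
  proof (rule set_eqI)
    fix v :: "'k kvec"
    have R: "tact ?T v (incalg_unit x x) \<in> range (tvec ?T)" by (simp add: tact_def)
    show "v \<in> ?L \<longleftrightarrow> v \<in> ?R"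
    proof
      assume "v \<in> ?L"
      then have v: "v \<in> range (tvec ?T)" "tact ?T v (incalg_unit x x) = v"
        by (simp_all add: weight_space_def carrier_inj_mod act_inj_mod)
      have "v (idx (0, z)) = 0" if "z \<noteq> x" for z
        using tact_unit_idx[of ?T v x x 0 z] that unfolding v(2) by simp
      then show "v \<in> ?R" using v(1) by simp
    next
      assume v: "v \<in> ?R"
      then have vz: "v \<in> range (tvec ?T)" "\<And>z. z \<noteq> x \<Longrightarrow> v (idx (0, z)) = 0" by auto
      have "tact ?T v (incalg_unit x x) = v"
      proof (rule tvec_eqI[OF R vz(1)])
        fix p assume "p \<in> ?T"
        then obtain z where "p = (0, z)" "z \<le> y" by auto
        then show "tact ?T v (incalg_unit x x) (idx p) = v (idx p)"
          using vz(2)[of z] by (auto simp: tact_unit_idx)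
      qed
      then show "v \<in> ?L" using v by (simp add: weight_space_def carrier_inj_mod act_inj_mod)
    qed
  qed
  show ?thesis
  proof (cases "x \<le> y")
    case True
    have S: "vscale c ?b \<in> range (tvec ?T)" for c
      by (rule kvec.subspace_scale[OF subspace_range_tvec]) simp
    have "v = vscale (v (idx (0, x))) ?b" if "v \<in> ?L" for v
    proof (rule tvec_eqI[OF _ S])
      from that have vz: "v \<in> range (tvec ?T)" "\<And>z. z \<noteq> x \<Longrightarrow> v (idx (0, z)) = 0"
        unfolding ws by auto
      show "v \<in> range (tvec ?T)" by (rule vz)
      fix p assume "p \<in> ?T"
      then obtain z where "p = (0, z)" "z \<le> y" by auto
      then show "v (idx p) = vscale (v (idx (0, x))) ?b (idx p)"
        using vz(2)[of z] True by (cases "z = x") (simp_all add: vscale_apply)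
    qed
    moreover have "vscale c ?b \<in> ?L" for c
      unfolding ws using S[of c] by (auto simp: vscale_apply simp del: image_iff)
    ultimately have "?L = range (\<lambda>c. vscale c ?b)" by blast
    moreover have "?b \<noteq> 0"
    proof
      assume "?b = 0"
      then have "?b (idx (0, x)) = 0" by simp
      then show False using True by simp
    qed
    ultimately show ?thesis using True kvec.dim_line by (simp add: dimvec_def)
  next
    case False
    have "v = 0" if "v \<in> ?L" for v
    proof (rule tvec_eqI[OF _ kvec.subspace_0[OF subspace_range_tvec]])
      from that have vz: "v \<in> range (tvec ?T)" "\<And>z. z \<noteq> x \<Longrightarrow> v (idx (0, z)) = 0"
        unfolding ws by auto
      show "v \<in> range (tvec ?T)" by (rule vz)
      fix p assume "p \<in> ?T"
      then obtain z where "p = (0, z)" "z \<le> y" by auto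
      then show "v (idx p) = 0 (idx p)"
        using vz(2)[of z] False by (cases "z = x") simp_all
    qed
    then have "?L = {0}" using kvec.subspace_0[OF subspace_weight_space] by blast
    then show ?thesis using False by (simp add: dimvec_def)
  qed
qed

text \<open>The element \<open>x\<close> is the largest of its lower set, so the basis vector at
  \<open>x\<close> can only be rescaled: every unit other than the one at \<open>x\<close> either
  starts elsewhere or leaves the index set.\<close>

lemma short_exact_simple_inj_mod:
  obtains Q where "short_exact (simple_module x) (inj_mod x :: ('x::{finite,order}, 'k::field) fdmod) Q"
proof -
  let ?T = "{0::nat} \<times> {..x}"
  let ?b = "tbasis ?T (0, x) :: 'k kvec"
  have b: "?b \<noteq> 0"
  proof
    assume "?b = 0"
    then have "?b (idx (0, x)) = 0" by simp
    then show False by simp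
  qed
  have b_act: "tact ?T ?b a = vscale (coeff a x x) ?b" for a
  proof (rule tvec_eqI[of _ ?T])
    show "tact ?T ?b a \<in> range (tvec ?T)" by (simp add: tact_def)
    show "vscale (coeff a x x) ?b \<in> range (tvec ?T)"
      by (rule kvec.subspace_scale[OF subspace_range_tvec]) simp
    fix p assume p: "p \<in> ?T"
    then obtain z where z: "p = (0, z)" "z \<le> x" by auto
    have "(\<Sum>u\<in>UNIV. ?b (idx (0, u)) * coeff a u z) = (\<Sum>u\<in>UNIV. if u = x then coeff a x z else 0)"
      by (intro sum.cong) auto
    then show "tact ?T ?b a (idx p) = vscale (coeff a x x) ?b (idx p)"
      using z coeff_eq_0[of x z a] by (auto simp: tact_idx vscale_def)
  qed
  show thesis
  proof (rule short_exact_simple_exists[of ?b "inj_mod x" x])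
    show "?b \<in> carrier (inj_mod x)" by (simp add: carrier_inj_mod)
    show "act (inj_mod x) ?b a = vscale (coeff a x x) ?b" for a
      unfolding act_inj_mod by (rule b_act)
  qed (rule b, rule that)
qed

text \<open>The unit from \<open>x\<close> to \<open>y\<close> moves the coordinate at
  \<open>x\<close> to the coordinate at \<open>y\<close>. Hence a homomorphism into
  \<open>inj_mod y\<close> is governed by the single functional that reads off the coordinate at
  \<open>y\<close>.\<close>

lemma mhom_inj_mod_idx:
  assumes f: "f \<in> mhom A (inj_mod y)" and v: "v \<in> carrier A" and "x \<le> y"
  shows "f v (idx (0, x)) = f (act A v (incalg_unit x y)) (idx (0, y))"
  using assms(3) by (simp add: mhom_act[OF f v] act_inj_mod tact_unit_idx)

lemma mhom_inj_mod_eqI: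
  assumes f: "f \<in> mhom A (inj_mod y)" and g: "g \<in> mhom A (inj_mod y)"
    and eq: "\<And>v. v \<in> carrier A \<Longrightarrow> f v (idx (0, y)) = g v (idx (0, y))"
  shows "f = g"
proof (rule mhom_eqI[OF f g])
  fix v assume v: "v \<in> carrier A"
  show "f v = g v"
  proof (rule tvec_eqI[of _ "{0} \<times> {..y}"])
    fix p assume "p \<in> {0::nat} \<times> {..y}"
    then show "f v (idx p) = g v (idx p)"
      using mhom_inj_mod_idx[OF f v] mhom_inj_mod_idx[OF g v] eq[OF act_carrier[OF v]] by auto
  qed (use mhom_carrier[OF f v] mhom_carrier[OF g v] in \<open>simp_all add: carrier_inj_mod\<close>)
qed

lemma incalg_times_unit:
  fixes a :: "('x::{finite,order}, 'k::field) incalg"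
  assumes "z \<le> y"
  shows "a * incalg_unit z y = (\<Sum>u\<in>UNIV. incalg_scale (coeff a u z) (incalg_unit u y))"
proof (rule incalg_eqI)
  fix p q
  have "(\<Sum>t\<in>UNIV. coeff a p t * coeff (incalg_unit z y :: ('x, 'k) incalg) t q) =
     (\<Sum>t\<in>UNIV. if t = z then (if q = y then coeff a p z else 0) else 0)"
    using assms by (intro sum.cong) (auto simp: coeff_unit)
  moreover have "(\<Sum>u\<in>UNIV. coeff a u z * coeff (incalg_unit u y :: ('x, 'k) incalg) p q) =
     (\<Sum>u\<in>UNIV. if u = p then (if q = y then coeff a p z else 0) else 0)"
    using assms order_trans[OF _ assms, of p] coeff_eq_0[of p z a]
    by (intro sum.cong) (auto simp: coeff_unit)
  ultimately show "coeff (a * incalg_unit z y) p q =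
      coeff (\<Sum>u\<in>UNIV. incalg_scale (coeff a u z) (incalg_unit u y)) p q"
    by (simp add: times_incalg.rep_eq coeff_sum incalg_scale.rep_eq)
qed

text \<open>The functor represented by \<open>inj_mod y\<close> is the dual of the weight space at \<open>y\<close>.\<close>

lemma mhom_inj_mod_exists:
  fixes A :: "('x::{finite,order}, 'k::field) fdmod" and lam :: "'k kvec \<Rightarrow> 'k"
  assumes add: "\<And>v w. v \<in> carrier A \<Longrightarrow> w \<in> carrier A \<Longrightarrow> lam (v + w) = lam v + lam w"
    and scale: "\<And>v c. v \<in> carrier A \<Longrightarrow> lam (vscale c v) = c * lam v"
    and weight: "\<And>v. v \<in> carrier A \<Longrightarrow> lam (act A v (incalg_unit y y)) = lam v"
  obtains f where "f \<in> mhom A (inj_mod y)" "\<And>v. v \<in> carrier A \<Longrightarrow> f v (idx (0, y)) = lam v"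
proof -
  let ?T = "{0::nat} \<times> {..y}"
  have lam0: "lam 0 = 0" using scale[of 0 0] by simp
  have sum: "lam (sum h I) = (\<Sum>i\<in>I. lam (h i))" if "\<And>i. i \<in> I \<Longrightarrow> h i \<in> carrier A" for h :: "'i \<Rightarrow> _" and I
    using that
  proof (induction I rule: infinite_finite_induct)
    case (insert i I)
    then have "h i \<in> carrier A" "sum h I \<in> carrier A" by (auto intro: sum_carrier)
    from add[OF this] insert show ?case by (simp only: sum.insert insert_iff simp_thms)
  qed (simp_all only: sum.infinite sum.empty lam0 if_False not_False_eq_True)
  \<comment> \<open>The coordinate at \<open>x\<close> is forced by
    \<open>mhom_inj_mod_idx\<close>.\<close>
  define f where "f = (\<lambda>v. if v \<in> carrier A then tvec ?T (\<lambda>(l, x). lam (act A v (incalg_unit x y))) else 0)"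
  note S = subspace_range_tvec[of ?T, where 'k='k]
  have R: "f v \<in> range (tvec ?T)" for v
    using kvec.subspace_0[OF S] by (simp add: f_def)
  have "f \<in> mhom A (inj_mod y)"
  proof (rule mhomI)
    show "v \<in> carrier A \<Longrightarrow> f v \<in> carrier (inj_mod y)" for v using R by (simp add: carrier_inj_mod)
    show "linear_on vscale vscale (carrier A) f"
      unfolding linear_on_def
    proof (intro conjI ballI allI)
      fix v c assume v: "v \<in> carrier A"
      show "f (vscale c v) = vscale c (f v)"
        by (rule tvec_eqI[OF R kvec.subspace_scale[OF S R]])
          (auto simp: f_def v scale_carrier act_scale_left[OF v] scale[OF act_carrier[OF v]], auto simp: vscale_def)
      fix w assume w: "w \<in> carrier A"
      show "f (v + w) = f v + f w"
        by (rule tvec_eqI[OF R kvec.subspace_add[OF S R R]])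
          (auto simp: f_def v w add_carrier act_add_left[OF v w] add[OF act_carrier[OF v] act_carrier[OF w]])
    qed
    fix v and a :: "('x, 'k) incalg" assume v: "v \<in> carrier A"
    show "f (act A v a) = act (inj_mod y) (f v) a"
      unfolding act_inj_mod
    proof (rule tvec_eqI[OF R])
      show "tact ?T (f v) a \<in> range (tvec ?T)" by (simp add: tact_def)
      fix p assume "p \<in> ?T"
      then obtain z where z: "p = (0, z)" "z \<le> y" by auto
      have "f (act A v a) (idx p) = lam (act A v (a * incalg_unit z y))"
        using z by (simp add: f_def act_carrier[OF v] act_mult[OF v])
      also have "\<dots> = lam (\<Sum>u\<in>UNIV. vscale (coeff a u z) (act A v (incalg_unit u y)))"
        by (simp add: incalg_times_unit[OF z(2)] act_sum_right[OF v] act_scale_right[OF v])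
      also have "\<dots> = (\<Sum>u\<in>UNIV. coeff a u z * lam (act A v (incalg_unit u y)))"
        by (simp add: sum scale act_carrier[OF v] scale_carrier)
      also have "\<dots> = (\<Sum>u\<in>UNIV. f v (idx (0, u)) * coeff a u z)"
        by (intro sum.cong) (auto simp: f_def v incalg_unit_eq_0 lam0)
      finally show "f (act A v a) (idx p) = tact ?T (f v) a (idx p)"
        using z by (simp add: tact_idx)
    qed
  qed (simp add: f_def)
  moreover have "f v (idx (0, y)) = lam v" if "v \<in> carrier A" for v
    using that by (simp add: f_def weight)
  ultimately show thesis using that by blast
qed

text \<open>The condition on kernels stands in place of injectivity of \<open>d\<close>, so one
  statement covers extension along a monomorphism, factorisation through an epimorphism and
  factorisation through a differential. A linear section of \<open>d\<close> is enough, because a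
  homomorphism into \<open>inj_mod y\<close> amounts to a linear functional on a weight
  space.\<close>

lemma inj_mod_injective:
  fixes A B :: "('x::{finite,order}, 'k::field) fdmod"
  assumes d: "d \<in> mhom A B" and f: "f \<in> mhom A (inj_mod y)"
    and ker: "\<And>v. v \<in> carrier A \<Longrightarrow> d v = 0 \<Longrightarrow> f v = 0"
  obtains g where "g \<in> mhom B (inj_mod y)" "g \<circ> d = f"
proof -
  obtain D where D: "Vector_Spaces.linear vscale vscale D" "\<And>v. v \<in> carrier A \<Longrightarrow> D v = d v"
    using kvec_pair.linear_on_extend[OF subspace_carrier linear_on_mhom[OF d]] by blast
  obtain s where s: "range s \<subseteq> carrier A" "Vector_Spaces.linear vscale vscale s"
      "\<And>w. w \<in> D ` carrier A \<Longrightarrow> D (s w) = w"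
    using kvec_pair.linear_exists_right_inverse_on[OF D(1) subspace_carrier, of A] by blast
  interpret s: Vector_Spaces.linear vscale vscale s by (rule s(2))
  have sA: "s w \<in> carrier A" for w using s(1) by auto
  \<comment> \<open>The preimage chosen by \<open>s\<close> may differ from \<open>v\<close>, but
    only by an element of the kernel of \<open>d\<close>.\<close>
  have fs: "f (s (d v)) = f v" if v: "v \<in> carrier A" for v
  proof -
    have "d (s (d v)) = d v" using s(3)[of "d v"] D(2) v sA by (metis imageI)
    then have "f (s (d v) - v) = 0"
      using ker diff_carrier[OF sA v] by (simp add: mhom_diff[OF d sA v])
    then show ?thesis by (simp add: mhom_diff[OF f sA v])
  qed
  \<comment> \<open>The section \<open>s\<close> may ignore weights; the idempotent at
    \<open>y\<close> makes the functional factor through the weight space at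
    \<open>y\<close>.\<close>
  define lam where "lam = (\<lambda>w. f (s (act B w (incalg_unit y y))) (idx (0, y)))"
  obtain g where g: "g \<in> mhom B (inj_mod y)" "\<And>w. w \<in> carrier B \<Longrightarrow> g w (idx (0, y)) = lam w"
  proof (rule mhom_inj_mod_exists[of B lam y])
    show "lam (v + w) = lam v + lam w" if "v \<in> carrier B" "w \<in> carrier B" for v w
      by (simp add: lam_def act_add_left[OF that] s.add mhom_add[OF f sA sA])
    show "lam (vscale c v) = c * lam v" if "v \<in> carrier B" for c v
      by (simp add: lam_def act_scale_left[OF that] s.scale mhom_scale[OF f sA]) (simp add: vscale_def)
    show "lam (act B v (incalg_unit y y)) = lam v" if "v \<in> carrier B" for v
      by (simp add: lam_def act_unit_unit[OF that])
  next
    fix f assume "f \<in> mhom B (inj_mod y)" "\<And>w. w \<in> carrier B \<Longrightarrow> f w (idx (0, y)) = lam w"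
    then show thesis by (rule that)
  qed
  have "g \<circ> d = f"
  proof (rule mhom_inj_mod_eqI[OF mhom_compose[OF g(1) d] f])
    fix v assume v: "v \<in> carrier A"
    have "(g \<circ> d) v (idx (0, y)) = f (act A v (incalg_unit y y)) (idx (0, y))"
      using mhom_carrier[OF d v]
      by (simp add: g(2) lam_def mhom_act[OF d v, symmetric] fs[OF act_carrier[OF v]])
    then show "(g \<circ> d) v (idx (0, y)) = f v (idx (0, y))"
      using mhom_inj_mod_idx[OF f v, of y] by simp
  qed
  then show thesis using that g(1) by blast
qed

section \<open>Exactness of Hom\<close>

lemma mhom_kernel_factor:
  assumes f: "f \<in> mhom L N" "inj_on f (carrier L)" and im: "f ` carrier L = mker N g"
    and h: "h \<in> mhom P N" "g \<circ> h = 0"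
  obtains k where "k \<in> mhom P L" "f \<circ> k = h"
proof -
  define k where "k = (\<lambda>v. if v \<in> carrier P then inv_into (carrier L) f (h v) else 0)"
  have hv: "h v \<in> f ` carrier L" for v
    unfolding im mker_def using mhom_carrier'[OF h(1)] fun_cong[OF h(2), of v] by simp
  have kL: "k v \<in> carrier L" for v
    using inv_into_into[OF hv] by (simp add: k_def)
  have fk: "f (k v) = h v" for v
    using f_inv_into_f[OF hv] mhom_outside[OF h(1)] mhom_zero[OF f(1)] by (simp add: k_def)
  have eqI: "k v = u" if "f u = h v" "u \<in> carrier L" for u v
    using inj_onD[OF f(2)] kL that fk by metis
  have "k \<in> mhom P L"
  proof (rule mhomI)
    show "linear_on vscale vscale (carrier P) k"
      unfolding linear_on_def
    proof (intro conjI ballI allI)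
      fix v w c assume v: "v \<in> carrier P"
      show "k (vscale c v) = vscale c (k v)"
        by (rule eqI) (simp_all add: mhom_scale[OF f(1)] mhom_scale[OF h(1)] kL v fk scale_carrier)
      assume w: "w \<in> carrier P"
      show "k (v + w) = k v + k w"
        by (rule eqI) (simp_all add: mhom_add[OF f(1)] mhom_add[OF h(1)] kL v w fk add_carrier)
    qed
    show "k (act P v a) = act L (k v) a" if "v \<in> carrier P" for v a
      by (rule eqI) (simp_all add: mhom_act[OF f(1)] mhom_act[OF h(1)] kL that fk act_carrier)
    show "v \<notin> carrier P \<Longrightarrow> k v = 0" for v by (simp add: k_def)
  qed (rule kL)
  moreover have "f \<circ> k = h" by (rule ext) (simp add: fk)
  ultimately show thesis by (rule that)
qed

lemma mhom_cancel_left: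
  assumes "inj_on f (carrier L)" "k \<in> mhom P L" "k' \<in> mhom P L" "f \<circ> k = f \<circ> k'"
  shows "k = k'"
  using assms mhom_carrier'[OF assms(2)] mhom_carrier'[OF assms(3)]
  by (metis comp_apply ext inj_on_def)

lemma mhom_cancel_right:
  assumes e: "e ` carrier P = carrier M" and k: "k \<in> mhom M N" "k' \<in> mhom M N" "k \<circ> e = k' \<circ> e"
  shows "k = k'"
proof (rule mhom_eqI[OF k(1,2)])
  fix v assume "v \<in> carrier M"
  then obtain u where "v = e u" using e by blast
  then show "k v = k' v" using fun_cong[OF k(3), of u] by simp
qed

lemma mhom_zero_module:
  assumes "carrier N = {0}"
  shows "mhom P N = {0}"
proof -
  have "f = 0" if "f \<in> mhom P N" for f
    using mhom_carrier'[OF that] assms by auto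
  then show ?thesis using khom.subspace_0[OF subspace_mhom] by blast
qed

lemma projectiveD:
  assumes "projective P" "g \<in> mhom N Q" "g ` carrier N = carrier Q" "h \<in> mhom P Q"
  obtains k where "k \<in> mhom P N" "g \<circ> k = h"
  using assms(1)[unfolded projective_def, rule_format, OF assms(2,4,3)] by (elim bexE)

lemma dim_mhom_projective:
  assumes P: "projective P" and ex: "short_exact L N Q"
  shows "khom.dim (mhom P N) = khom.dim (mhom P L) + khom.dim (mhom P Q)"
proof -
  obtain f g where fg: "f \<in> mhom L N" "g \<in> mhom N Q" "inj_on f (carrier L)"
    "f ` carrier L = mker N g" "g ` carrier N = carrier Q" using short_exactE[OF ex] .
  have "(\<lambda>h. g \<circ> h) ` mhom P N = mhom P Q"
  proof
    show "mhom P Q \<subseteq> (\<lambda>h. g \<circ> h) ` mhom P N"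
    proof
      fix k assume "k \<in> mhom P Q"
      then obtain h where "h \<in> mhom P N" "g \<circ> h = k" by (rule projectiveD[OF P fg(2,5)])
      then show "k \<in> (\<lambda>h. g \<circ> h) ` mhom P N" by auto
    qed
  qed (auto intro: mhom_compose[OF fg(2)])
  moreover have "{h \<in> mhom P N. g \<circ> h = 0} = (\<lambda>k. f \<circ> k) ` mhom P L"
  proof
    show "{h \<in> mhom P N. g \<circ> h = 0} \<subseteq> (\<lambda>k. f \<circ> k) ` mhom P L"
    proof clarify
      fix h assume "h \<in> mhom P N" "g \<circ> h = 0"
      then obtain k where "k \<in> mhom P L" "f \<circ> k = h" by (rule mhom_kernel_factor[OF fg(1,3,4)])
      then show "h \<in> (\<lambda>k. f \<circ> k) ` mhom P L" by auto
    qed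
    have "g (f v) = 0" if "v \<in> carrier L" for v using fg(4) that unfolding mker_def by blast
    then have "g \<circ> (f \<circ> k) = 0" if "k \<in> mhom P L" for k
      using mhom_carrier'[OF that] by (intro ext) simp
    then show "(\<lambda>k. f \<circ> k) ` mhom P L \<subseteq> {h \<in> mhom P N. g \<circ> h = 0}"
      using mhom_compose[OF fg(1)] by auto
  qed
  moreover have "khom.dim ((\<lambda>k. f \<circ> k) ` mhom P L) = khom.dim (mhom P L)"
    by (rule khom_pair.dim_inj_image[OF fin_subspace_mhom linear_on_postcompose[OF fg(1)]])
      (rule inj_onI, rule mhom_cancel_left[OF fg(3)])
  ultimately show ?thesis
    using khom_pair.rank_nullity[OF fin_subspace_mhom linear_on_postcompose[OF fg(2)], of P] by simp
qed

lemma dim_mhom_simple_inj_mod: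
  "khom.dim (mhom (simple_module x :: ('x::{finite,order}, 'k::field) fdmod) (inj_mod y)) = (if x = y then 1 else 0)"
proof (cases "x = y")
  case False
  let ?S = "simple_module x :: ('x, 'k) fdmod"
  have "f = 0" if f: "f \<in> mhom ?S (inj_mod y)" for f
  proof (rule mhom_inj_mod_eqI[OF f khom.subspace_0[OF subspace_mhom]])
    fix v assume v: "v \<in> carrier ?S"
    have "f v (idx (0, y)) = f (act ?S v (incalg_unit y y)) (idx (0, y))"
      by (rule mhom_inj_mod_idx[OF f v order_refl])
    moreover have "act ?S v (incalg_unit y y) = 0"
      using False by (simp only: act_simple_module_unit[OF order_refl]) auto
    ultimately show "f v (idx (0, y)) = 0 v (idx (0, y))"
      by (simp only: mhom_zero[OF f] zero_fun_apply)
  qed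
  then have "mhom ?S (inj_mod y) = {0}" using khom.subspace_0[OF subspace_mhom] by blast
  then show ?thesis using False by simp
next
  case True
  let ?S = "simple_module y :: ('x, 'k) fdmod"
  let ?e = "(\<lambda>i. if i = 0 then 1 else 0) :: 'k kvec"
  obtain g where g: "g \<in> mhom ?S (inj_mod y)" "\<And>v. v \<in> carrier ?S \<Longrightarrow> g v (idx (0, y)) = v 0"
    by (rule mhom_inj_mod_exists[of ?S "\<lambda>v. v 0" y])
      (auto simp: vscale_apply act_simple_module_unit simp del: act_simple_module)
  have eS: "?e \<in> carrier ?S" by simp
  have "f = hscale (f ?e (idx (0, y))) g" if f: "f \<in> mhom ?S (inj_mod y)" for f
  proof (rule mhom_inj_mod_eqI[OF f khom.subspace_scale[OF subspace_mhom g(1)]])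
    fix v assume v: "v \<in> carrier ?S"
    then have "v = vscale (v 0) ?e" by (auto simp: vscale_def fun_eq_iff)
    then have "f v = vscale (v 0) (f ?e)" using mhom_scale[OF f eS] by metis
    then show "f v (idx (0, y)) = hscale (f ?e (idx (0, y))) g v (idx (0, y))"
      using g(2)[OF v] by (simp add: hscale_def vscale_apply)
  qed
  then have "mhom ?S (inj_mod y) = range (\<lambda>c. hscale c g)"
    using khom.subspace_scale[OF subspace_mhom g(1)] by blast
  moreover have "g \<noteq> 0" using g(2)[OF eS] by auto
  ultimately show ?thesis using khom.dim_line True by simp
qed

text \<open>Both sides are additive on short exact sequences and agree on simple modules. For the
  left side \<open>inj_mod_injective\<close> is used twice, to extend along \<open>f\<close> and to
  factor through \<open>g\<close>.\<close>

lemma dim_mhom_inj_mod: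
  fixes M :: "('x::{finite,order}, 'k::field) fdmod"
  shows "khom.dim (mhom M (inj_mod y)) = dimvec M y"
proof (induction M rule: fdmod_induct)
  case (zero M)
  have "mhom M (inj_mod y) = {0}"
  proof -
    have "f = 0" if f: "f \<in> mhom M (inj_mod y)" for f
      by (rule mhom_eqI[OF f khom.subspace_0[OF subspace_mhom]])
        (use zero mhom_zero[OF f] in simp)
    then show ?thesis using khom.subspace_0[OF subspace_mhom] by blast
  qed
  moreover have "weight_space M y = {0}"
    using zero by (auto simp: weight_space_def)
  ultimately show ?case by (simp add: dimvec_def)
next
  case (step x N Q)
  let ?S = "simple_module x :: ('x, 'k) fdmod" and ?I = "inj_mod y :: ('x, 'k) fdmod"
  obtain f g where fg: "f \<in> mhom ?S N" "g \<in> mhom N Q" "inj_on f (carrier ?S)"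
    "f ` carrier ?S = mker N g" "g ` carrier N = carrier Q" using short_exactE[OF step(1)] .
  have "(\<lambda>h. h \<circ> f) ` mhom N ?I = mhom ?S ?I"
  proof
    show "(\<lambda>h. h \<circ> f) ` mhom N ?I \<subseteq> mhom ?S ?I" by (auto intro: mhom_compose fg(1))
    show "mhom ?S ?I \<subseteq> (\<lambda>h. h \<circ> f) ` mhom N ?I"
    proof
      fix k assume k: "k \<in> mhom ?S ?I"
      have "k v = 0" if v: "v \<in> carrier ?S" "f v = 0" for v
        using inj_onD[OF fg(3), of v 0] v mhom_zero[OF fg(1)] mhom_zero[OF k] by simp
      then obtain h where "h \<in> mhom N ?I" "h \<circ> f = k" by (rule inj_mod_injective[OF fg(1) k])
      then show "k \<in> (\<lambda>h. h \<circ> f) ` mhom N ?I" by auto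
    qed
  qed
  moreover have "{h \<in> mhom N ?I. h \<circ> f = 0} = (\<lambda>h. h \<circ> g) ` mhom Q ?I"
  proof
    have "g (f v) = 0" for v
    proof (cases "v \<in> carrier ?S")
      case True
      then have "f v \<in> mker N g" using fg(4) by blast
      then show ?thesis by (simp add: mker_def)
    qed (simp add: mhom_outside[OF fg(1)] mhom_zero[OF fg(2)] del: carrier_simple_module)
    then have "(h \<circ> g) \<circ> f = 0" if "h \<in> mhom Q ?I" for h
      using mhom_zero[OF that] by (intro ext) simp
    then show "(\<lambda>h. h \<circ> g) ` mhom Q ?I \<subseteq> {h \<in> mhom N ?I. h \<circ> f = 0}"
      using mhom_compose[OF _ fg(2)] by blast
    show "{h \<in> mhom N ?I. h \<circ> f = 0} \<subseteq> (\<lambda>h. h \<circ> g) ` mhom Q ?I"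
    proof clarify
      fix h assume h: "h \<in> mhom N ?I" "h \<circ> f = 0"
      have "h v = 0" if v: "v \<in> carrier N" "g v = 0" for v
      proof -
        have "v \<in> f ` carrier ?S" using v unfolding fg(4) mker_def by blast
        then obtain u where "v = f u" by blast
        then show ?thesis using fun_cong[OF h(2), of u] by simp
      qed
      then obtain k where "k \<in> mhom Q ?I" "k \<circ> g = h" by (rule inj_mod_injective[OF fg(2) h(1)])
      then show "h \<in> (\<lambda>h. h \<circ> g) ` mhom Q ?I" by auto
    qed
  qed
  moreover have "khom.dim ((\<lambda>h. h \<circ> g) ` mhom Q ?I) = khom.dim (mhom Q ?I)"
    by (rule khom_pair.dim_inj_image[OF fin_subspace_mhom linear_precompose])
      (rule inj_onI, rule mhom_cancel_right[OF fg(5)])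
  ultimately have "khom.dim (mhom N ?I) = khom.dim (mhom ?S ?I) + khom.dim (mhom Q ?I)"
    using khom_pair.rank_nullity[OF fin_subspace_mhom linear_precompose, of N ?I f] by simp
  then show ?case
    using step(2) dimvec_short_exact[OF step(1)] by (simp add: dim_mhom_simple_inj_mod dimvec_simple)
qed

section \<open>Ext for a fixed projective resolution\<close>

locale resolution =
  fixes M :: "('x::{finite,order}, 'k::field) fdmod" and P d e
  assumes res: "projective_resolution M P d e"
begin

lemma proj: "projective (P i)" and d_hom: "d i \<in> mhom (P (Suc i)) (P i)"
  and e_hom: "e \<in> mhom (P 0) M" and e_surj: "e ` carrier (P 0) = carrier M"
  and d_0: "d 0 ` carrier (P (Suc 0)) = mker (P 0) e"
  and d_Suc: "d (Suc i) ` carrier (P (Suc (Suc i))) = mker (P (Suc i)) (d i)"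
  using res by (auto simp: projective_resolution_def)

lemma d_d [simp]: "d i (d (Suc i) v) = 0"
proof (cases "v \<in> carrier (P (Suc (Suc i)))")
  case True
  then have "d (Suc i) v \<in> mker (P (Suc i)) (d i)" using d_Suc by blast
  then show ?thesis by (simp add: mker_def)
qed (simp add: mhom_outside[OF d_hom] mhom_zero[OF d_hom])

abbreviation "Z N i \<equiv> ext_cocycles P d N i"
abbreviation "B N i \<equiv> ext_coboundaries P d N i"

lemma Z_eq: "Z N i = {f \<in> mhom (P i) N. f \<circ> d i = 0}"
  by (simp add: ext_cocycles_def zero_fun_def)

lemma B_0: "B N 0 = {0}"
  by (simp add: ext_coboundaries_def zero_fun_def)

lemma B_Suc: "B N (Suc i) = (\<lambda>f. f \<circ> d i) ` mhom (P i) N"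
  by (simp add: ext_coboundaries_def)

lemmas lift = projectiveD[OF proj]

lemma Z_mhom: "f \<in> Z N i \<Longrightarrow> f \<in> mhom (P i) N"
  by (simp add: Z_eq)

lemma subspace_Z: "khom.subspace (Z N i)"
  unfolding Z_eq by (rule khom_pair.subspace_linear_on_kernel[OF subspace_mhom linear_precompose])

lemma fin_subspace_Z: "fin_subspace hscale (Z N i)"
  by (rule khom.fin_subspace_subset[OF fin_subspace_mhom subspace_Z]) (auto simp: Z_eq)

lemma fin_subspace_B: "fin_subspace hscale (B N i)"
proof (cases i)
  case 0
  then show ?thesis using khom.fin_subspace_span[of "{}"] by (simp add: B_0)
next
  case (Suc j)
  then show ?thesis
    using khom_pair.fin_subspace_linear_on_image[OF fin_subspace_mhom linear_precompose] by (simp add: B_Suc)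
qed

lemma B_subset_Z: "B N i \<subseteq> Z N i"
proof (cases i)
  case 0
  then show ?thesis using khom.subspace_0[OF subspace_Z] by (simp add: B_0)
next
  case (Suc j)
  have "(f \<circ> d j) \<circ> d (Suc j) = 0" if "f \<in> mhom (P j) N" for f
    using mhom_zero[OF that] by (intro ext) simp
  then show ?thesis using mhom_compose[OF _ d_hom] unfolding Suc B_Suc Z_eq by blast
qed

lemma dim_B_le_dim_Z: "khom.dim (B N i) \<le> khom.dim (Z N i)"
  by (rule khom.dim_mono_fin_subspace[OF fin_subspace_Z B_subset_Z])

lemma dim_mhom: "khom.dim (mhom (P i) N) = khom.dim (B N (Suc i)) + khom.dim (Z N i)"
  unfolding B_Suc Z_eq by (rule khom_pair.rank_nullity[OF fin_subspace_mhom linear_precompose])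

section \<open>Vanishing of Ext in large degrees\<close>

definition ext_vanishes :: "('x, 'k) fdmod \<Rightarrow> nat \<Rightarrow> bool" where
  "ext_vanishes N i \<longleftrightarrow> Z N i \<subseteq> B N i"

lemma ext_vanishes_iff: "ext_vanishes N i \<longleftrightarrow> khom.dim (Z N i) - khom.dim (B N i) = 0"
  using khom.fin_subspace_eq_iff_dim[OF fin_subspace_Z khom.fin_subspace_imp_subspace[OF fin_subspace_B] B_subset_Z]
    B_subset_Z unfolding ext_vanishes_def by blast

lemma ext_vanishes_zero: "carrier N = {0} \<Longrightarrow> ext_vanishes N i"
  unfolding ext_vanishes_def
  using mhom_zero_module[of N] khom.subspace_0[OF khom.fin_subspace_imp_subspace[OF fin_subspace_B]]
  by (auto simp: Z_eq)

text \<open>Exactness of the long exact sequence at its middle term. The image of a cocycle in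
  \<open>Q\<close> is a coboundary, and the map from \<open>P j\<close> to \<open>Q\<close> that
  bounds it lifts to \<open>N\<close>; the corrected cocycle takes values in \<open>L\<close>, where
  it is a coboundary again.\<close>

lemma ext_vanishes_middle:
  assumes ex: "short_exact L N Q" and L: "ext_vanishes L (Suc j)" and Q: "ext_vanishes Q (Suc j)"
  shows "ext_vanishes N (Suc j)"
  unfolding ext_vanishes_def
proof
  obtain f g where fg: "f \<in> mhom L N" "g \<in> mhom N Q" "inj_on f (carrier L)"
    "f ` carrier L = mker N g" "g ` carrier N = carrier Q" using short_exactE[OF ex] .
  fix h assume "h \<in> Z N (Suc j)"
  then have h: "h \<in> mhom (P (Suc j)) N" and hd: "h (d (Suc j) v) = 0" for v
    by (auto simp: Z_eq fun_eq_iff)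
  have "(g \<circ> h) \<circ> d (Suc j) = 0" by (rule ext) (simp add: hd mhom_zero[OF fg(2)])
  then have "g \<circ> h \<in> Z Q (Suc j)" using mhom_compose[OF fg(2) h] unfolding Z_eq by blast
  then have "g \<circ> h \<in> B Q (Suc j)" using Q by (auto simp: ext_vanishes_def)
  then obtain k' where k': "k' \<in> mhom (P j) Q" "g \<circ> h = k' \<circ> d j" by (auto simp: B_Suc)
  obtain k where k: "k \<in> mhom (P j) N" "g \<circ> k = k'" by (rule lift[OF fg(2,5) k'(1)])
  have kd: "k \<circ> d j \<in> mhom (P (Suc j)) N" by (rule mhom_compose[OF k(1) d_hom])
  have gk: "g (h v) = g (k (d j v))" for v
    using fun_cong[OF k'(2), of v] unfolding k(2)[symmetric] by simp
  have diff: "h - (k \<circ> d j) \<in> mhom (P (Suc j)) N" by (rule khom.subspace_diff[OF subspace_mhom h kd])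
  have "g \<circ> (h - (k \<circ> d j)) = 0"
    by (rule ext) (simp add: fun_diff_def[of h] mhom_diff[OF fg(2) mhom_carrier'[OF h] mhom_carrier'[OF k(1)]] gk)
  with diff obtain l where l: "l \<in> mhom (P (Suc j)) L" "f \<circ> l = h - (k \<circ> d j)"
    by (rule mhom_kernel_factor[OF fg(1,3,4)])
  have fl: "f (l v) = h v - k (d j v)" for v
    using fun_cong[OF l(2), of v] by (simp add: fun_diff_def[of h])
  have "l \<circ> d (Suc j) = 0"
    by (rule mhom_cancel_left[OF fg(3) mhom_compose[OF l(1) d_hom] khom.subspace_0[OF subspace_mhom]])
      (rule ext, simp add: fl hd mhom_zero[OF fg(1)] mhom_zero[OF k(1)])
  then have "l \<in> B L (Suc j)" using L l(1) unfolding ext_vanishes_def Z_eq by blast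
  then obtain m where m: "m \<in> mhom (P j) L" "l = m \<circ> d j" by (auto simp: B_Suc)
  have "k + (f \<circ> m) \<in> mhom (P j) N"
    by (rule khom.subspace_add[OF subspace_mhom k(1) mhom_compose[OF fg(1) m(1)]])
  moreover have "h = (k + (f \<circ> m)) \<circ> d j"
  proof
    fix v show "h v = ((k + (f \<circ> m)) \<circ> d j) v"
      using fl[of v] by (simp add: m(2) eq_diff_eq add.commute)
  qed
  ultimately show "h \<in> B N (Suc j)" by (auto simp: B_Suc)
qed

text \<open>Exactness of the long exact sequence at Ext of \<open>L\<close>, between Ext of
  \<open>Q\<close> one degree lower and Ext of \<open>N\<close> in the same degree. The map
  \<open>k\<close> bounds \<open>f \<circ> h\<close> in \<open>N\<close>; as its image in
  \<open>Q\<close> is a coboundary, \<open>k\<close> can be corrected to take values in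
  \<open>L\<close>.\<close>

lemma ext_vanishes_shift:
  assumes ex: "short_exact L N Q" and N: "ext_vanishes N (Suc (Suc j))" and Q: "ext_vanishes Q (Suc j)"
  shows "ext_vanishes L (Suc (Suc j))"
  unfolding ext_vanishes_def
proof
  obtain f g where fg: "f \<in> mhom L N" "g \<in> mhom N Q" "inj_on f (carrier L)"
    "f ` carrier L = mker N g" "g ` carrier N = carrier Q" using short_exactE[OF ex] .
  have gf: "g (f v) = 0" if "v \<in> carrier L" for v using fg(4) that unfolding mker_def by blast
  fix h assume "h \<in> Z L (Suc (Suc j))"
  then have h: "h \<in> mhom (P (Suc (Suc j))) L" and hd: "h (d (Suc (Suc j)) v) = 0" for v
    by (auto simp: Z_eq fun_eq_iff)
  have "(f \<circ> h) \<circ> d (Suc (Suc j)) = 0" by (rule ext) (simp add: hd mhom_zero[OF fg(1)])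
  then have "f \<circ> h \<in> Z N (Suc (Suc j))" using mhom_compose[OF fg(1) h] unfolding Z_eq by blast
  then have "f \<circ> h \<in> B N (Suc (Suc j))" using N by (auto simp: ext_vanishes_def)
  then obtain k where k: "k \<in> mhom (P (Suc j)) N" "f \<circ> h = k \<circ> d (Suc j)" by (auto simp: B_Suc)
  have fh: "k (d (Suc j) v) = f (h v)" for v using fun_cong[OF k(2), of v] by simp
  have "(g \<circ> k) \<circ> d (Suc j) = 0" by (rule ext) (simp add: fh gf[OF mhom_carrier'[OF h]])
  then have "g \<circ> k \<in> Z Q (Suc j)" using mhom_compose[OF fg(2) k(1)] unfolding Z_eq by blast
  then have "g \<circ> k \<in> B Q (Suc j)" using Q by (auto simp: ext_vanishes_def)
  then obtain m' where m': "m' \<in> mhom (P j) Q" "g \<circ> k = m' \<circ> d j" by (auto simp: B_Suc)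
  obtain m where m: "m \<in> mhom (P j) N" "g \<circ> m = m'" by (rule lift[OF fg(2,5) m'(1)])
  have gk: "g (k v) = g (m (d j v))" for v
    using fun_cong[OF m'(2), of v] unfolding m(2)[symmetric] by simp
  have diff: "k - (m \<circ> d j) \<in> mhom (P (Suc j)) N"
    by (rule khom.subspace_diff[OF subspace_mhom k(1) mhom_compose[OF m(1) d_hom]])
  have "g \<circ> (k - (m \<circ> d j)) = 0"
    by (rule ext) (simp add: fun_diff_def[of k] mhom_diff[OF fg(2) mhom_carrier'[OF k(1)] mhom_carrier'[OF m(1)]] gk)
  with diff obtain l where l: "l \<in> mhom (P (Suc j)) L" "f \<circ> l = k - (m \<circ> d j)"
    by (rule mhom_kernel_factor[OF fg(1,3,4)])
  have fl: "f (l v) = k v - m (d j v)" for v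
    using fun_cong[OF l(2), of v] by (simp add: fun_diff_def[of k])
  have "h = l \<circ> d (Suc j)"
    by (rule mhom_cancel_left[OF fg(3) h mhom_compose[OF l(1) d_hom]])
      (rule ext, simp add: fl fh mhom_zero[OF m(1)])
  then show "h \<in> B L (Suc (Suc j))" using l(1) by (auto simp: B_Suc)
qed

text \<open>A cocycle vanishes on the image of \<open>d (Suc i)\<close>, which is the kernel of
  \<open>d i\<close>, so it factors through \<open>d i\<close> by injectivity.\<close>

lemma ext_vanishes_inj_mod: "ext_vanishes (inj_mod y) (Suc i)"
  unfolding ext_vanishes_def
proof
  fix h assume "h \<in> Z (inj_mod y) (Suc i)"
  then have h: "h \<in> mhom (P (Suc i)) (inj_mod y)" and hd: "h (d (Suc i) v) = 0" for v
    by (auto simp: Z_eq fun_eq_iff)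
  have "h v = 0" if v: "v \<in> carrier (P (Suc i))" "d i v = 0" for v
  proof -
    have "v \<in> d (Suc i) ` carrier (P (Suc (Suc i)))" using v unfolding d_Suc mker_def by blast
    then show ?thesis using hd by blast
  qed
  then obtain k where "k \<in> mhom (P i) (inj_mod y)" "k \<circ> d i = h"
    by (rule inj_mod_injective[OF d_hom h])
  then show "h \<in> B (inj_mod y) (Suc i)" by (auto simp: B_Suc)
qed

lemma ext_vanishes_support:
  assumes "\<And>x. dimvec N x \<noteq> 0 \<Longrightarrow> ext_vanishes (simple_module x) (Suc i)"
  shows "ext_vanishes N (Suc i)"
  using assms
proof (induction N rule: fdmod_induct)
  case (zero N)
  then show ?case by (simp add: ext_vanishes_zero)
next
  case (step x N Q)
  note dv = dimvec_short_exact[OF step(1)]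
  have "ext_vanishes Q (Suc i)" using step(2,3) dv by simp
  moreover have "ext_vanishes (simple_module x) (Suc i)" using step(3)[of x] dv[of x] by (simp add: dimvec_simple)
  ultimately show ?case using ext_vanishes_middle[OF step(1)] by blast
qed

lemma ext_vanishes_simple: "\<exists>n. \<forall>i\<ge>n. ext_vanishes (simple_module x) i"
proof (induction "card {z. z < x}" arbitrary: x rule: less_induct)
  case less
  have "\<exists>n. \<forall>i\<ge>n. ext_vanishes (simple_module z) i" if "z < x" for z
  proof (rule less)
    have "{w. w < z} \<subset> {w. w < x}" using that by (auto intro: less_trans)
    then show "card {w. w < z} < card {w. w < x}" by (simp add: psubset_card_mono)
  qed
  then obtain n where n: "\<And>z i. z < x \<Longrightarrow> n z \<le> i \<Longrightarrow> ext_vanishes (simple_module z) i" by metis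
  obtain Q where Q: "short_exact (simple_module x) (inj_mod x :: ('x, 'k) fdmod) Q"
    by (rule short_exact_simple_inj_mod)
  \<comment> \<open>The sum dominates every single \<open>n z\<close>, and the two extra degrees put
    \<open>i\<close> in the form \<open>Suc (Suc j)\<close> required by the shift, with
    \<open>Suc j\<close> still above all the bounds.\<close>
  have "ext_vanishes (simple_module x) i" if "Suc (Suc (\<Sum>z\<in>UNIV. n z)) \<le> i" for i
  proof -
    define j where "j = i - 2"
    have j: "i = Suc (Suc j)" "(\<Sum>z\<in>UNIV. n z) \<le> j"
      using that by (simp_all add: j_def)
    have "ext_vanishes Q (Suc j)"
    proof (rule ext_vanishes_support)
      fix z assume z: "dimvec Q z \<noteq> 0"
      have "(if z \<le> x then 1 else 0) = (if z = x then 1 else 0) + dimvec Q z"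
        using dimvec_short_exact[OF Q, of z] by (simp only: dimvec_inj_mod dimvec_simple)
      then have "z \<le> x" "z \<noteq> x" using z by (auto split: if_splits)
      then have "z < x" by simp
      moreover have "n z \<le> (\<Sum>z\<in>UNIV. n z)" by (rule member_le_sum) auto
      then have "n z \<le> Suc j" using j(2) by linarith
      ultimately show "ext_vanishes (simple_module z) (Suc j)" by (rule n)
    qed
    then show ?thesis unfolding j(1) by (rule ext_vanishes_shift[OF Q ext_vanishes_inj_mod])
  qed
  then show ?case by blast
qed

text \<open>There are finitely many simple modules, so the bound can be chosen before
  \<open>N\<close>. It is taken positive because coboundaries in that degree have to come from a
  preceding term.\<close>

lemma ext_vanishes_bound: "\<exists>n>0. \<forall>i\<ge>n. \<forall>N. ext_vanishes N i"
proof -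
  obtain n where n: "\<And>x i. n x \<le> i \<Longrightarrow> ext_vanishes (simple_module x) i"
    using ext_vanishes_simple by metis
  have "ext_vanishes N i" if i: "Suc (\<Sum>x\<in>UNIV. n x) \<le> i" for N i
  proof -
    obtain j where "i = Suc j" using i Suc_le_D by blast
    moreover have "n x \<le> i" for x using member_le_sum[of x UNIV n] i by simp
    ultimately show ?thesis using ext_vanishes_support n by blast
  qed
  then show ?thesis by blast
qed

text \<open>Coboundaries map onto coboundaries by lifting. An element of the kernel has the form
  \<open>f \<circ> l\<close> with a cocycle \<open>l\<close>, and vanishing for \<open>L\<close> is
  what makes \<open>l\<close> a coboundary.\<close>

lemma dim_B_additive:
  assumes ex: "short_exact L N Q" and L: "ext_vanishes L (Suc j)"
  shows "khom.dim (B N (Suc j)) = khom.dim (B L (Suc j)) + khom.dim (B Q (Suc j))"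
proof -
  obtain f g where fg: "f \<in> mhom L N" "g \<in> mhom N Q" "inj_on f (carrier L)"
    "f ` carrier L = mker N g" "g ` carrier N = carrier Q" using short_exactE[OF ex] .
  have gf: "g (f v) = 0" if "v \<in> carrier L" for v using fg(4) that unfolding mker_def by blast
  have Bm: "h \<in> mhom (P (Suc j)) N'" if "h \<in> B N' (Suc j)" for h N'
    using that B_subset_Z Z_mhom by blast
  have lin: "linear_on hscale hscale (B N' (Suc j)) (\<lambda>h. g' \<circ> h)" if "g' \<in> mhom N' N''" for g' N' N''
    by (rule linear_on_subset[OF linear_on_postcompose[OF that]]) (use Bm in blast)
  have "(\<lambda>h. g \<circ> h) ` B N (Suc j) = B Q (Suc j)"
  proof
    show "(\<lambda>h. g \<circ> h) ` B N (Suc j) \<subseteq> B Q (Suc j)"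
    proof clarify
      fix h assume "h \<in> B N (Suc j)"
      then obtain k where "k \<in> mhom (P j) N" "h = k \<circ> d j" by (auto simp: B_Suc)
      then show "g \<circ> h \<in> B Q (Suc j)"
        using mhom_compose[OF fg(2)] unfolding B_Suc by (auto simp: comp_assoc[symmetric])
    qed
    show "B Q (Suc j) \<subseteq> (\<lambda>h. g \<circ> h) ` B N (Suc j)"
    proof
      fix h assume "h \<in> B Q (Suc j)"
      then obtain k where k: "k \<in> mhom (P j) Q" "h = k \<circ> d j" by (auto simp: B_Suc)
      obtain m where m: "m \<in> mhom (P j) N" "g \<circ> m = k" by (rule lift[OF fg(2,5) k(1)])
      have "h = g \<circ> (m \<circ> d j)" using k(2) m(2) by (simp add: comp_assoc[symmetric])
      then show "h \<in> (\<lambda>h. g \<circ> h) ` B N (Suc j)" using m(1) by (auto simp: B_Suc)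
    qed
  qed
  moreover have "{h \<in> B N (Suc j). g \<circ> h = 0} = (\<lambda>h. f \<circ> h) ` B L (Suc j)"
  proof
    show "(\<lambda>h. f \<circ> h) ` B L (Suc j) \<subseteq> {h \<in> B N (Suc j). g \<circ> h = 0}"
    proof clarify
      fix h assume h: "h \<in> B L (Suc j)"
      then obtain k where "k \<in> mhom (P j) L" "h = k \<circ> d j" by (auto simp: B_Suc)
      then have "f \<circ> h \<in> B N (Suc j)"
        using mhom_compose[OF fg(1)] unfolding B_Suc by (auto simp: comp_assoc[symmetric])
      moreover have "g \<circ> (f \<circ> h) = 0"
        using gf[OF mhom_carrier'[OF Bm[OF h]]] by (intro ext) simp
      ultimately show "f \<circ> h \<in> B N (Suc j) \<and> g \<circ> (f \<circ> h) = 0" by blast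
    qed
    show "{h \<in> B N (Suc j). g \<circ> h = 0} \<subseteq> (\<lambda>h. f \<circ> h) ` B L (Suc j)"
    proof clarify
      fix h assume h: "h \<in> B N (Suc j)" "g \<circ> h = 0"
      obtain l where l: "l \<in> mhom (P (Suc j)) L" "f \<circ> l = h"
        using Bm[OF h(1)] h(2) by (rule mhom_kernel_factor[OF fg(1,3,4)])
      have hZ: "h \<circ> d (Suc j) = 0" using h(1) B_subset_Z by (auto simp: Z_eq)
      have "l \<circ> d (Suc j) = 0"
        by (rule mhom_cancel_left[OF fg(3) mhom_compose[OF l(1) d_hom] khom.subspace_0[OF subspace_mhom]])
          (use hZ mhom_zero[OF fg(1)] in \<open>simp add: l(2)[symmetric] fun_eq_iff\<close>)
      then have "l \<in> B L (Suc j)" using L l(1) unfolding ext_vanishes_def Z_eq by blast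
      then show "h \<in> (\<lambda>h. f \<circ> h) ` B L (Suc j)" using l(2) by auto
    qed
  qed
  moreover have "khom.dim ((\<lambda>h. f \<circ> h) ` B L (Suc j)) = khom.dim (B L (Suc j))"
    by (rule khom_pair.dim_inj_image[OF fin_subspace_B lin[OF fg(1)]])
      (rule inj_onI, rule mhom_cancel_left[OF fg(3)], auto intro: Bm)
  ultimately show ?thesis
    using khom_pair.rank_nullity[OF fin_subspace_B lin[OF fg(2)]] by simp
qed

definition ext_d :: "('x, 'k) fdmod \<Rightarrow> nat \<Rightarrow> nat" where
  "ext_d N i = khom.dim (Z N i) - khom.dim (B N i)"

text \<open>The alternating sum telescopes up to a boundary term, which is additive in \<open>N\<close> as soon as
  Ext vanishes in degree \<open>n\<close>.\<close>

lemma sum_ext_d: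
  "(\<Sum>i<n. (- 1) ^ i * int (ext_d N i)) =
    (\<Sum>i<n. (- 1) ^ i * int (khom.dim (mhom (P i) N))) + (- 1) ^ n * int (khom.dim (B N n))"
proof (induction n)
  case (Suc n)
  have "int (khom.dim (Z N n)) = int (ext_d N n) + int (khom.dim (B N n))"
    using dim_B_le_dim_Z[of N n] by (simp add: ext_d_def of_nat_diff)
  then have "int (khom.dim (mhom (P n) N)) =
      int (khom.dim (B N (Suc n))) + int (ext_d N n) + int (khom.dim (B N n))"
    by (simp add: dim_mhom)
  then show ?case using Suc by (simp add: algebra_simps)
qed (simp add: B_0)

text \<open>The augmentation \<open>e\<close> identifies Hom from \<open>M\<close> with the cocycles
  of degree zero: such a cocycle kills the kernel of \<open>e\<close>, so it factors through
  \<open>e\<close>. The dimension is then known from \<open>dim_mhom_inj_mod\<close>.\<close>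

lemma ext_d_inj_mod_0: "ext_d (inj_mod y) 0 = dimvec M y"
proof -
  let ?I = "inj_mod y"
  have ed: "e (d 0 v) = 0" for v
  proof (cases "v \<in> carrier (P (Suc 0))")
    case True
    then have "d 0 v \<in> mker (P 0) e" using d_0 by blast
    then show ?thesis by (simp add: mker_def)
  qed (simp add: mhom_outside[OF d_hom] mhom_zero[OF e_hom])
  have "Z ?I 0 = (\<lambda>f. f \<circ> e) ` mhom M ?I"
  proof
    have "(f \<circ> e) \<circ> d 0 = 0" if "f \<in> mhom M ?I" for f
      using mhom_zero[OF that] ed by (intro ext) simp
    then show "(\<lambda>f. f \<circ> e) ` mhom M ?I \<subseteq> Z ?I 0"
      using mhom_compose[OF _ e_hom] unfolding Z_eq by blast
    show "Z ?I 0 \<subseteq> (\<lambda>f. f \<circ> e) ` mhom M ?I"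
    proof
      fix h assume "h \<in> Z ?I 0"
      then have h: "h \<in> mhom (P 0) ?I" and hd: "h (d 0 v) = 0" for v
        by (auto simp: Z_eq fun_eq_iff)
      have "h v = 0" if v: "v \<in> carrier (P 0)" "e v = 0" for v
      proof -
        have "v \<in> d 0 ` carrier (P (Suc 0))" using v unfolding d_0 mker_def by blast
        then show ?thesis using hd by blast
      qed
      then obtain k where "k \<in> mhom M ?I" "k \<circ> e = h" by (rule inj_mod_injective[OF e_hom h])
      then show "h \<in> (\<lambda>f. f \<circ> e) ` mhom M ?I" by auto
    qed
  qed
  moreover have "khom.dim ((\<lambda>f. f \<circ> e) ` mhom M ?I) = khom.dim (mhom M ?I)"
    by (rule khom_pair.dim_inj_image[OF fin_subspace_mhom linear_precompose])
      (rule inj_onI, rule mhom_cancel_right[OF e_surj])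
  ultimately show ?thesis by (simp add: ext_d_def B_0 dim_mhom_inj_mod)
qed

end

section \<open>The Euler characteristic\<close>

text \<open>The choice in \<open>ext_dim\<close> depends on \<open>M\<close> alone, so the same
  resolution serves all \<open>N\<close> and all degrees, and everything proved in the locale
  applies to it.\<close>

lemma ext_dim_resolution:
  fixes M :: "('x::{finite,order}, 'k::field) fdmod"
  obtains P d e where "resolution M P d e" "\<And>N i. ext_dim i M N = resolution.ext_d P d N i"
proof -
  define q where "q = (SOME (P, d, e). projective_resolution M P d e)"
  obtain P d e where q: "q = (P, d, e)" by (cases q)
  have "\<exists>r. case r of (P, d, e) \<Rightarrow> projective_resolution M P d e"
    using projective_resolution_exists[of M] by auto
  then have "case q of (P, d, e) \<Rightarrow> projective_resolution M P d e"
    unfolding q_def by (rule someI_ex)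
  then have r: "resolution M P d e" by (simp add: q resolution_def)
  have "ext_dim i M N = resolution.ext_d P d N i" for N i
    unfolding ext_dim_def resolution.ext_d_def[OF r] q_def[symmetric] q by simp
  with r show thesis by (rule that)
qed

text \<open>With \<open>n\<close> in the vanishing range, the telescoped sum consists of Hom spaces
  from the \<open>P i\<close>, additive by projectivity, and the boundary term in degree
  \<open>n\<close>, additive by \<open>dim_B_additive\<close>. For an injective hull only degree
  zero contributes.\<close>

lemma
  fixes M :: "('x::{finite,order}, 'k::field) fdmod"
  shows euler_char_additive: "short_exact L N Q \<Longrightarrow> euler_char M N = euler_char M L + euler_char M Q"
    and euler_char_zero: "carrier N = {0} \<Longrightarrow> euler_char M N = 0"
    and euler_char_inj_mod: "euler_char M (inj_mod y) = int (dimvec M y)"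
proof -
  obtain P d e where r: "resolution M P d e" and ext: "\<And>N i. ext_dim i M N = resolution.ext_d P d N i"
    using ext_dim_resolution[of M] by blast
  interpret resolution M P d e by (rule r)
  obtain n where n: "n > 0" "\<And>i N. n \<le> i \<Longrightarrow> ext_vanishes N i" using ext_vanishes_bound by blast
  then obtain j where j: "n = Suc j" using gr0_implies_Suc by blast
  have vanish: "ext_dim i M N = 0" if "ext_vanishes N i" for N i
    using that by (simp add: ext ext_d_def ext_vanishes_iff)
  \<comment> \<open>The summation set in \<open>euler_char\<close> varies with \<open>N\<close>;
    comparing three modules calls for a common range.\<close>
  have chi: "euler_char M N = (\<Sum>i<n. (- 1) ^ i * int (ext_d N i))" for N
  proof -
    have zero: "ext_d N i = 0" if "n \<le> i" for i using vanish[OF n(2)[OF that]] by (simp add: ext)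
    have "{i. ext_d N i \<noteq> 0} \<subseteq> {..<n}"
    proof
      fix i assume "i \<in> {i. ext_d N i \<noteq> 0}"
      then have "\<not> n \<le> i" using zero[of i] by auto
      then show "i \<in> {..<n}" by simp
    qed
    then show ?thesis unfolding euler_char_def ext by (intro sum.mono_neutral_left) auto
  qed
  show "euler_char M N = euler_char M L + euler_char M Q" if ex: "short_exact L N Q"
  proof -
    have "khom.dim (B N n) = khom.dim (B L n) + khom.dim (B Q n)"
      unfolding j by (rule dim_B_additive[OF ex]) (use n(2) j in simp)
    then show ?thesis
      unfolding chi sum_ext_d by (simp add: dim_mhom_projective[OF proj ex] sum.distrib algebra_simps)
  qed
  show "euler_char M N = 0" if "carrier N = {0}"
    using vanish[OF ext_vanishes_zero[OF that]] by (simp add: euler_char_def)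
  have "ext_d (inj_mod y) i = 0" if "i \<noteq> 0" for i
    using that vanish[OF ext_vanishes_inj_mod[where y=y and i="i - 1"]] by (simp add: ext)
  then have "(\<Sum>i<n. (- 1) ^ i * int (ext_d (inj_mod y) i)) =
      (\<Sum>i<n. if i = 0 then int (dimvec M y) else 0)"
    by (intro sum.cong) (auto simp: ext_d_inj_mod_0)
  then show "euler_char M (inj_mod y) = int (dimvec M y)"
    using n(1) by (simp add: chi)
qed

lemma sum_UNIV_if: "(\<Sum>x\<in>UNIV. if Q x then f x else 0) = (\<Sum>x | Q x. f x)"
  for f :: "'i::finite \<Rightarrow> 'a::comm_monoid_add"
  by (simp add: sum.If_cases)

lemma euler_char_eq_sum:
  fixes M N :: "('x::{finite,order}, 'k::field) fdmod"
  shows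
  "euler_char M N = (\<Sum>x\<in>UNIV. int (dimvec N x) * euler_char M (simple_module x))"
proof (induction N rule: fdmod_induct)
  case (zero N)
  then have "weight_space N x = {0}" for x by (auto simp: weight_space_def)
  then show ?case using zero by (simp add: euler_char_zero dimvec_def)
next
  case (step y N Q)
  have "(\<Sum>x\<in>UNIV. int (dimvec (simple_module y :: ('x, 'k) fdmod) x) * euler_char M (simple_module x)) =
      (\<Sum>x\<in>UNIV. if x = y then euler_char M (simple_module y) else 0)"
    by (intro sum.cong) (auto simp: dimvec_simple)
  then show ?case
    using step(2) euler_char_additive[OF step(1), of M] dimvec_short_exact[OF step(1)]
    by (simp add: algebra_simps sum.distrib)
qed

lemma sum_euler_char_simple:
  fixes M :: "('x::{finite,order}, 'k::field) fdmod"
  shows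
  "(\<Sum>x | x \<le> y. euler_char M (simple_module x)) = int (dimvec M y)"
proof -
  have "(\<Sum>x\<in>UNIV. int (dimvec (inj_mod y :: ('x, 'k) fdmod) x) * euler_char M (simple_module x)) =
      (\<Sum>x | x \<le> y. euler_char M (simple_module x))"
    unfolding sum_UNIV_if[symmetric] by (intro sum.cong) (auto simp: dimvec_inj_mod)
  then show ?thesis
    using euler_char_eq_sum[of M "inj_mod y"] by (simp only: euler_char_inj_mod)
qed

section \<open>The Euler form is the Moebius function\<close>

text \<open>Over the reals a one-sided inverse of a square matrix is two-sided; the entrywise
  embedding of the integers is multiplicative and injective, so the equation can be carried there
  and back.\<close>

lemma int_matrix_left_inverse_imp_right:
  fixes A B :: "int ^ 'n ^ 'n"
  assumes "A ** B = mat 1"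
  shows "B ** A = mat 1"
proof -
  define R :: "int ^ 'n ^ 'n \<Rightarrow> real ^ 'n ^ 'n" where "R A = (\<chi> i j. of_int (A $ i $ j))" for A
  have mult: "R (A ** B) = R A ** R B" for A B
    by (simp add: R_def matrix_matrix_mult_def vec_eq_iff)
  have one: "R (mat 1) = mat 1" by (simp add: R_def mat_def vec_eq_iff)
  have inj: "A = B" if "R A = R B" for A B using that by (simp add: R_def vec_eq_iff)
  have "R B ** R A = mat 1" using assms mult[of A B] one matrix_left_right_inverse by metis
  then show ?thesis using inj mult one by metis
qed

definition euler_matrix :: "'k::field itself \<Rightarrow> int ^ 'x::{finite,order} ^ 'x::{finite,order}" where
  "euler_matrix _ = (\<chi> x y. euler_char (simple_module x :: ('x, 'k) fdmod) (simple_module y))"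

lemma euler_matrix_incidence: "euler_matrix TYPE('k::field) ** incidence_matrix = (mat 1 :: int ^ 'x::{finite,order} ^ 'x::{finite,order})"
proof -
  have "(\<Sum>z\<in>UNIV. euler_char (simple_module x :: ('x, 'k) fdmod) (simple_module z) * (if z \<le> y then 1 else 0)) =
     (if x = y then 1 else 0)" for x y
  proof -
    have "(\<Sum>z\<in>UNIV. euler_char (simple_module x :: ('x, 'k) fdmod) (simple_module z) * (if z \<le> y then 1 else 0)) =
       (\<Sum>z | z \<le> y. euler_char (simple_module x :: ('x, 'k) fdmod) (simple_module z))"
      by (simp add: if_distrib[of "\<lambda>t. _ * t"] sum_UNIV_if cong: if_cong)
    then show ?thesis by (simp add: sum_euler_char_simple dimvec_simple)
  qed
  then show ?thesis
    by (simp add: matrix_matrix_mult_def euler_matrix_def incidence_matrix_def mat_def vec_eq_iff)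
qed

text \<open>\<open>matrix_inv\<close> is a choice, so a two-sided inverse is exhibited before
  anything is known about it; uniqueness of inverses then identifies the two. As the left side
  mentions no field, the Euler matrix is the same over every field.\<close>

lemma matrix_inv_incidence_matrix:
  "matrix_inv incidence_matrix = (euler_matrix TYPE('k::field) :: int ^ 'x::{finite,order} ^ 'x::{finite,order})"
proof -
  let ?C = "euler_matrix TYPE('k) :: int ^ 'x::{finite,order} ^ 'x::{finite,order}"
    and ?A = "incidence_matrix :: int ^ 'x::{finite,order} ^ 'x::{finite,order}"
  have C: "?C ** ?A = mat 1" by (rule euler_matrix_incidence)
  have C': "?A ** ?C = mat 1" by (rule int_matrix_left_inverse_imp_right[OF C])
  have "?A ** matrix_inv ?A = mat 1 \<and> matrix_inv ?A ** ?A = mat 1"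
    unfolding matrix_inv_def by (rule someI_ex) (use C C' in blast)
  then have "?C = (?C ** ?A) ** matrix_inv ?A"
    by (metis matrix_mul_assoc matrix_mul_rid)
  then show ?thesis using C by (simp add: matrix_mul_lid)
qed

lemma sum_incidence_moebius:
  fixes x z :: "'x::{finite,order}"
  shows "(\<Sum>y | x \<le> y. moebius y z) = (if x = z then 1 else 0)"
    and "(\<Sum>y | y \<le> z. moebius x y) = (if x = z then 1 else 0)"
proof -
  \<comment> \<open>Any field yields a two-sided inverse of the incidence matrix; \<open>rat\<close>
    is a concrete choice for a claim that mentions none.\<close>
  let ?A = "incidence_matrix :: int ^ 'x::{finite,order} ^ 'x::{finite,order}" and ?C = "euler_matrix TYPE(rat)"
  have "?C ** ?A = mat 1" by (rule euler_matrix_incidence)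
  then have "matrix_inv ?A ** ?A = mat 1" "?A ** matrix_inv ?A = mat 1"
    using int_matrix_left_inverse_imp_right by (auto simp: matrix_inv_incidence_matrix[where 'k=rat])
  then have "(matrix_inv ?A ** ?A) $ x $ z = (if x = z then 1 else 0)"
    "(?A ** matrix_inv ?A) $ x $ z = (if x = z then 1 else 0)"
    by (simp_all add: mat_def)
  then show "(\<Sum>y | x \<le> y. moebius y z) = (if x = z then 1 else 0)"
    "(\<Sum>y | y \<le> z. moebius x y) = (if x = z then 1 else 0)"
    by (simp_all add: matrix_matrix_mult_def moebius_def incidence_matrix_def sum_UNIV_if
      if_distrib[of "\<lambda>t. _ * t"] if_distrib[of "\<lambda>t. t * _"] cong: if_cong)
qed

text \<open>Moebius inversion of \<open>sum_euler_char_simple\<close>: each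
  \<open>dimvec M x\<close> is a sum over the elements below \<open>x\<close>, and after exchanging
  the sums the Moebius function undoes it.\<close>

lemma euler_char_eq:
  "euler_char M N = (\<Sum>x\<in>UNIV. \<Sum>y\<in>UNIV. int (dimvec M x) * moebius x y * int (dimvec N y))"
proof -
  have simple: "euler_char M (simple_module y) = (\<Sum>x\<in>UNIV. int (dimvec M x) * moebius x y)" for y
  proof -
    have "(\<Sum>x\<in>UNIV. int (dimvec M x) * moebius x y) =
        (\<Sum>x\<in>UNIV. \<Sum>z\<in>UNIV. if z \<le> x then euler_char M (simple_module z) * moebius x y else 0)"
      by (simp add: sum_euler_char_simple[symmetric] sum_distrib_right sum_UNIV_if)
    also have "\<dots> = (\<Sum>z\<in>UNIV. \<Sum>x\<in>UNIV. if z \<le> x then euler_char M (simple_module z) * moebius x y else 0)"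
      by (rule sum.swap)
    also have "\<dots> = (\<Sum>z\<in>UNIV. euler_char M (simple_module z) * (\<Sum>x | z \<le> x. moebius x y))"
      by (simp add: sum_distrib_left sum_UNIV_if)
    also have "\<dots> = euler_char M (simple_module y)"
      by (simp add: sum_incidence_moebius(1) if_distrib[of "\<lambda>t. _ * t"] cong: if_cong)
    finally show ?thesis by simp
  qed
  have "euler_char M N = (\<Sum>y\<in>UNIV. \<Sum>x\<in>UNIV. int (dimvec M x) * moebius x y * int (dimvec N y))"
    by (subst euler_char_eq_sum) (simp add: simple sum_distrib_left mult_ac)
  also have "\<dots> = (\<Sum>x\<in>UNIV. \<Sum>y\<in>UNIV. int (dimvec M x) * moebius x y * int (dimvec N y))"
    by (rule sum.swap)
  finally show ?thesis .
qed

section \<open>The Grothendieck group is free on the simple modules\<close>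

text \<open>Dimension vectors are encoded in the free abelian group on the poset so that
  \<open>frag_extend\<close> provides the additive extension to formal combinations of
  modules.\<close>

definition dim_frag :: "('x::{finite,order}, 'k::field) fdmod \<Rightarrow> 'x \<Rightarrow>\<^sub>0 int" where
  "dim_frag M = (\<Sum>x\<in>UNIV. frag_cmul (int (dimvec M x)) (frag_of x))"

lemma lookup_sum_frag: "poly_mapping.lookup (\<Sum>x\<in>UNIV. frag_cmul (c x) (frag_of x)) y = c y"
  for c :: "'x::finite \<Rightarrow> int"
proof -
  have "poly_mapping.lookup (\<Sum>x\<in>UNIV. frag_cmul (c x) (frag_of x)) y = (\<Sum>x\<in>UNIV. if x = y then c y else 0)"
    unfolding lookup_sum by (intro sum.cong) auto
  then show ?thesis by simp
qed

lemma dim_frag_short_exact: "short_exact L M N \<Longrightarrow> dim_frag M = dim_frag L + dim_frag N"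
  by (rule poly_mapping_eqI)
    (simp add: dim_frag_def lookup_sum_frag lookup_add dimvec_short_exact)

lift_definition K0_dim :: "('x::{finite,order}, 'k::field) K0 \<Rightarrow> 'x \<Rightarrow>\<^sub>0 int" is "frag_extend dim_frag"
proof -
  fix a b :: "('x, 'k) fdmod \<Rightarrow>\<^sub>0 int"
  have "frag_extend dim_frag c = 0" if "c \<in> K0_relations" for c :: "('x, 'k) fdmod \<Rightarrow>\<^sub>0 int"
    using that by induction (simp_all add: frag_extend_diff dim_frag_short_exact)
  moreover assume "a - b \<in> K0_relations"
  ultimately have "frag_extend dim_frag (a - b) = 0" .
  then show "frag_extend dim_frag a = frag_extend dim_frag b" by (simp add: frag_extend_diff)
qed

definition K0_coord :: "('x::{finite,order}, 'k::field) K0 \<Rightarrow> 'x \<Rightarrow> int" where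
  "K0_coord u x = poly_mapping.lookup (K0_dim u) x"

lemma K0_coord_zero [simp]: "K0_coord 0 x = 0"
  unfolding K0_coord_def by transfer simp

lemma K0_coord_add [simp]: "K0_coord (u + v) x = K0_coord u x + K0_coord v x"
  unfolding K0_coord_def by transfer (simp add: frag_extend_add lookup_add)

lemma K0_coord_diff [simp]: "K0_coord (u - v) x = K0_coord u x - K0_coord v x"
  unfolding K0_coord_def by transfer (simp add: frag_extend_diff lookup_minus)

lemma K0_coord_scale [simp]: "K0_coord (K0_scale n u) x = n * K0_coord u x"
  unfolding K0_coord_def by transfer (simp add: frag_extend_cmul)

lemma K0_coord_class [simp]: "K0_coord (K0_class M) x = int (dimvec M x)"
  unfolding K0_coord_def by transfer (simp add: dim_frag_def lookup_sum_frag)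

lemma K0_coord_sum [simp]: "K0_coord (sum h I) x = (\<Sum>i\<in>I. K0_coord (h i) x)"
  by (induction I rule: infinite_finite_induct) auto

lemma K0_induct [case_names zero cls diff]:
  assumes zero: "P 0" and cls: "\<And>M. P (K0_class M)" and diff: "\<And>u v. P u \<Longrightarrow> P v \<Longrightarrow> P (u - v)"
  shows "P u"
proof (induction u rule: K0.abs_induct)
  fix c :: "('a, 'b) fdmod \<Rightarrow>\<^sub>0 int"
  show "P (abs_K0 c)"
  proof (rule frag_induction[where c=c and S=UNIV and P="\<lambda>c. P (abs_K0 c)"])
    show "P (abs_K0 0)" using zero by (simp add: zero_K0_def)
    show "P (abs_K0 (frag_of M))" for M using cls[of M] by (simp add: K0_class.abs_eq)
    show "P (abs_K0 (a - b))" if "P (abs_K0 a)" "P (abs_K0 b)" for a b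
      using diff[OF that] by (simp add: minus_K0.abs_eq)
  qed simp
qed

lemma K0_scale_add: "K0_scale (m + n) u = K0_scale m u + K0_scale n u"
  by transfer (simp add: frag_cmul_distrib K0_relations.zero)

lemma K0_scale_diff: "K0_scale (m - n) u = K0_scale m u - K0_scale n u"
  by transfer (simp add: frag_cmul_diff_distrib K0_relations.zero)

lemma K0_scale_zero: "K0_scale 0 u = 0"
  by transfer (simp add: K0_relations.zero)

lemma K0_scale_one: "K0_scale 1 u = u"
  by transfer (simp add: K0_relations.zero)

lemma K0_class_short_exact:
  assumes "short_exact L M N"
  shows "K0_class M = K0_class L + K0_class N"
proof -
  have "K0_class M - K0_class L - K0_class N = 0"
    using assms by transfer (simp add: K0_relations.short_exact)
  then show ?thesis by (simp add: algebra_simps)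
qed

text \<open>With carrier zero, the zero maps make \<open>M\<close>, \<open>M\<close>,
  \<open>M\<close> a short exact sequence, whence the class equals its double.\<close>

lemma K0_class_zero:
  assumes "carrier M = {0}"
  shows "K0_class M = 0"
proof -
  have id: "(\<lambda>_. 0) \<in> mhom M M" by (rule zero_mhom)
  have "short_exact M M M"
    unfolding short_exact_def by (intro bexI[OF _ id]) (auto simp: assms mker_def)
  then show ?thesis using K0_class_short_exact[of M M M] by simp
qed

text \<open>Classes of modules are unravelled by \<open>fdmod_induct\<close>, general elements by
  differences. Together with \<open>K0_coord_combination\<close> this shows that the simple classes
  form a basis.\<close>

lemma K0_expand:
  fixes u :: "('x::{finite,order}, 'k::field) K0"
  shows "u = (\<Sum>x\<in>UNIV. K0_scale (K0_coord u x) (K0_class (simple_module x)))"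
proof (induction u rule: K0_induct)
  case zero
  then show ?case by (simp add: K0_scale_zero)
next
  case (diff u v)
  then show ?case by (simp add: K0_scale_diff sum_subtractf)
next
  case (cls M)
  show ?case
  proof (induction M rule: fdmod_induct)
    case (zero N)
    then have "weight_space N x = {0}" for x by (auto simp: weight_space_def)
    then show ?case using zero by (simp add: K0_class_zero dimvec_def K0_scale_zero)
  next
    case (step y N Q)
    have "(\<Sum>x\<in>UNIV. K0_scale (int (dimvec (simple_module y :: ('x, 'k) fdmod) x)) (K0_class (simple_module x :: ('x, 'k) fdmod))) =
      (\<Sum>x\<in>UNIV. if x = y then K0_class (simple_module y) else 0)"
      by (intro sum.cong) (auto simp: dimvec_simple K0_scale_zero K0_scale_one)
    then have "K0_class (simple_module y) + K0_class Q =
        (\<Sum>x\<in>UNIV. K0_scale (K0_coord (K0_class (simple_module y) :: ('x, 'k) K0) x) (K0_class (simple_module x))) +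
        (\<Sum>x\<in>UNIV. K0_scale (K0_coord (K0_class Q) x) (K0_class (simple_module x)))"
      by (subst step(2)) simp
    also have "\<dots> = (\<Sum>x\<in>UNIV. K0_scale (K0_coord (K0_class (simple_module y) + K0_class Q) x)
        (K0_class (simple_module x)))"
      by (simp only: K0_coord_add K0_scale_add sum.distrib)
    finally show ?case unfolding K0_class_short_exact[OF step(1)] .
  qed
qed

lemma K0_coord_eqI: "(\<And>x. K0_coord u x = K0_coord v x) \<Longrightarrow> u = v"
  by (subst K0_expand[of u], subst K0_expand[of v]) simp

lemma K0_coord_combination:
  fixes c :: "'x::{finite,order} \<Rightarrow> int"
  shows "K0_coord (\<Sum>x\<in>UNIV. K0_scale (c x) (K0_class (simple_module x :: ('x, 'k::field) fdmod))) y = c y"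
proof -
  have "(\<Sum>x\<in>UNIV. c x * int (dimvec (simple_module x :: ('x, 'k) fdmod) y)) = (\<Sum>x\<in>UNIV. if x = y then c y else 0)"
    by (intro sum.cong) (auto simp: dimvec_simple)
  then show ?thesis by simp
qed

lemma simple_coord_eq: "simple_coord u = K0_coord u"
  unfolding simple_coord_def
proof (rule the_equality)
  show "u = (\<Sum>x\<in>UNIV. K0_scale (K0_coord u x) (K0_class (simple_module x)))" by (rule K0_expand)
  show "c = K0_coord u" if "u = (\<Sum>x\<in>UNIV. K0_scale (c x) (K0_class (simple_module x)))" for c
    by (rule ext) (simp only: that K0_coord_combination)
qed

section \<open>The Euler form and the Coxeter transformation\<close>

text \<open>The bilinear expression extends the Euler characteristic by
  \<open>euler_char_eq\<close>, and two biadditive extensions agree because classes of modules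
  generate the group under differences.\<close>

lemma euler_form_eq:
  fixes u v :: "('x::{finite,order}, 'k::field) K0"
  shows "euler_form u v = (\<Sum>x\<in>UNIV. \<Sum>y\<in>UNIV. K0_coord u x * moebius x y * K0_coord v y)"
proof -
  define E :: "('x, 'k) K0 \<Rightarrow> ('x, 'k) K0 \<Rightarrow> int" where
    "E = (\<lambda>u v. \<Sum>x\<in>UNIV. \<Sum>y\<in>UNIV. K0_coord u x * moebius x y * K0_coord v y)"
  have E_diff: "E (u - u') v = E u v - E u' v" "E u (v - v') = E u v - E u v'" for u u' v v'
    by (simp_all add: E_def algebra_simps sum_subtractf)
  have E_zero: "E 0 v = 0" "E u 0 = 0" for u v by (simp_all add: E_def)
  have eq: "euler_form = E"
    unfolding euler_form_def
  proof (rule the_equality)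
    show "(\<forall>u u' v. E (u + u') v = E u v + E u' v) \<and> (\<forall>u v v'. E u (v + v') = E u v + E u v') \<and>
        (\<forall>M N. E (K0_class M) (K0_class N) = euler_char M N)"
      by (simp add: E_def algebra_simps sum.distrib euler_char_eq)
  next
    fix B :: "('x, 'k) K0 \<Rightarrow> ('x, 'k) K0 \<Rightarrow> int"
    assume "(\<forall>u u' v. B (u + u') v = B u v + B u' v) \<and> (\<forall>u v v'. B u (v + v') = B u v + B u v') \<and>
        (\<forall>M N. B (K0_class M) (K0_class N) = euler_char M N)"
    then have B: "\<And>u u' v. B (u + u') v = B u v + B u' v" "\<And>u v v'. B u (v + v') = B u v + B u v'"
        "\<And>M N. B (K0_class M) (K0_class N) = euler_char M N"
      by blast+
    have B_diff: "B (u - u') v = B u v - B u' v" "B u (v - v') = B u v - B u v'" for u u' v v'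
      using B(1)[of "u - u'" u' v] B(2)[of u "v - v'" v'] by simp_all
    have B_zero: "B 0 v = 0" "B u 0 = 0" for u v using B_diff(1)[of 0 0 v] B_diff(2)[of u 0 0] by simp_all
    have "B u v = E u v" for u v
    proof (induction u rule: K0_induct)
      case (cls M)
      show ?case
      proof (induction v rule: K0_induct)
        case (cls N)
        show ?case by (simp add: B(3) E_def euler_char_eq)
      qed (simp_all add: B_zero E_zero B_diff E_diff)
    qed (simp_all add: B_zero E_zero B_diff E_diff)
    then show "B = E" by (intro ext)
  qed
  show ?thesis unfolding eq E_def ..
qed

text \<open>The simple modules at the elements above \<open>x\<close> are the composition factors of
  the projective cover at \<open>x\<close>, each occurring once. Pairing with the sum of their
  classes, the class of this projective, reads off the coordinate at \<open>x\<close>.\<close>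

lemma euler_form_nondegenerate:
  fixes v w :: "('x::{finite,order}, 'k::field) K0"
  assumes "\<And>u. euler_form u v = euler_form u w"
  shows "v = w"
proof (rule K0_coord_eqI)
  fix x
  have expand: "K0_coord v x = (\<Sum>a | x \<le> a. euler_form (K0_class (simple_module a)) v)"
    for v :: "('x, 'k) K0"
  proof -
    have "euler_form (K0_class (simple_module a)) v = (\<Sum>y\<in>UNIV. moebius a y * K0_coord v y)" for a
    proof -
      have "euler_form (K0_class (simple_module a)) v =
          (\<Sum>b\<in>UNIV. if b = a then \<Sum>y\<in>UNIV. moebius a y * K0_coord v y else 0)"
        unfolding euler_form_eq by (intro sum.cong) (auto simp: dimvec_simple)
      then show ?thesis by simp
    qed
    then have "(\<Sum>a | x \<le> a. euler_form (K0_class (simple_module a)) v) =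
        (\<Sum>a | x \<le> a. \<Sum>y\<in>UNIV. moebius a y * K0_coord v y)" by simp
    also have "\<dots> = (\<Sum>y\<in>UNIV. \<Sum>a | x \<le> a. moebius a y * K0_coord v y)"
      by (rule sum.swap)
    also have "\<dots> = (\<Sum>y\<in>UNIV. (\<Sum>a | x \<le> a. moebius a y) * K0_coord v y)"
      by (simp add: sum_distrib_right)
    also have "\<dots> = (\<Sum>y\<in>UNIV. if x = y then K0_coord v y else 0)"
      by (intro sum.cong) (auto simp: sum_incidence_moebius(1))
    finally show ?thesis by simp
  qed
  show "K0_coord v x = K0_coord w x" by (simp add: expand assms)
qed

text \<open>The function \<open>c\<close> solves the defining equation in coordinates, which is
  possible because the Euler matrix has the incidence matrix as its inverse. Nondegeneracy makes the
  description in \<open>coxeter\<close> unique.\<close>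

lemma K0_coord_coxeter:
  fixes u :: "('x::{finite,order}, 'k::field) K0"
  shows "K0_coord (coxeter u) x = - (\<Sum>z | x \<le> z. \<Sum>y\<in>UNIV. K0_coord u y * moebius y z)"
proof -
  define c where "c = (\<lambda>(u :: ('x, 'k) K0) x. - (\<Sum>z | x \<le> z. \<Sum>y\<in>UNIV. K0_coord u y * moebius y z))"
  define \<Phi> :: "('x, 'k) K0 \<Rightarrow> ('x, 'k) K0" where
    "\<Phi> = (\<lambda>u. \<Sum>x\<in>UNIV. K0_scale (c u x) (K0_class (simple_module x)))"
  have coord: "K0_coord (\<Phi> u) x = c u x" for u x
    by (simp only: \<Phi>_def K0_coord_combination)
  have main: "euler_form u v = - euler_form v (\<Phi> u)" for u v
  proof -
    \<comment> \<open>Summing \<open>moebius a x\<close> over all \<open>x \<le> z\<close> gives the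
      identity matrix, so the incidence matrix contained in \<open>c\<close> cancels and the
      transposed Euler matrix remains.\<close>
    have inner: "(\<Sum>x\<in>UNIV. moebius a x * c u x) = - (\<Sum>y\<in>UNIV. K0_coord u y * moebius y a)" for a
    proof -
      have "(\<Sum>x\<in>UNIV. moebius a x * c u x) =
          - (\<Sum>x\<in>UNIV. \<Sum>z\<in>UNIV. if x \<le> z then moebius a x * (\<Sum>y\<in>UNIV. K0_coord u y * moebius y z) else 0)"
        by (simp add: c_def sum_UNIV_if sum_distrib_left sum_negf)
      also have "\<dots> = - (\<Sum>z\<in>UNIV. \<Sum>x\<in>UNIV. if x \<le> z then moebius a x * (\<Sum>y\<in>UNIV. K0_coord u y * moebius y z) else 0)"
        by (subst sum.swap) (rule refl)
      also have "\<dots> = - (\<Sum>z\<in>UNIV. (\<Sum>x | x \<le> z. moebius a x) * (\<Sum>y\<in>UNIV. K0_coord u y * moebius y z))"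
        by (simp only: sum_UNIV_if sum_distrib_right)
      also have "\<dots> = - (\<Sum>z\<in>UNIV. if a = z then \<Sum>y\<in>UNIV. K0_coord u y * moebius y z else 0)"
        by (intro arg_cong[of _ _ uminus] sum.cong) (auto simp: sum_incidence_moebius(2))
      finally show ?thesis by simp
    qed
    have "euler_form v (\<Phi> u) = (\<Sum>a\<in>UNIV. K0_coord v a * (\<Sum>x\<in>UNIV. moebius a x * c u x))"
      by (simp add: euler_form_eq coord sum_distrib_left mult.assoc)
    also have "\<dots> = - (\<Sum>a\<in>UNIV. \<Sum>y\<in>UNIV. K0_coord u y * moebius y a * K0_coord v a)"
      by (simp add: inner sum_negf sum_distrib_left mult_ac)
    also have "\<dots> = - euler_form u v"
      unfolding euler_form_eq by (subst sum.swap) (rule refl)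
    finally show ?thesis by simp
  qed
  have eq: "coxeter = \<Phi>"
    unfolding coxeter_def
  proof (rule the_equality)
    show "\<forall>u v. euler_form u v = - euler_form v (\<Phi> u)" using main by blast
    fix \<Psi> :: "('x, 'k) K0 \<Rightarrow> ('x, 'k) K0"
    assume \<Psi>: "\<forall>u v. euler_form u v = - euler_form v (\<Psi> u)"
    have "euler_form v (\<Psi> u) = euler_form v (\<Phi> u)" for u v
      using main[of u v] \<Psi>[rule_format, of u v] by simp
    then show "\<Psi> = \<Phi>" by (intro ext euler_form_nondegenerate)
  qed
  show ?thesis unfolding eq coord c_def ..
qed

theorem lemma3p6:
  fixes x y :: "'x::{finite,order}"
  shows "coxeter_matrix TYPE('k::field) $ x $ y = - (\<Sum>z | x \<le> z. moebius y z)"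
proof -
  have "(\<Sum>w\<in>UNIV. int (dimvec (simple_module y :: ('x, 'k) fdmod) w) * moebius w z) =
      (\<Sum>w\<in>UNIV. if w = y then moebius y z else 0)" for z
    by (intro sum.cong) (auto simp: dimvec_simple)
  then show ?thesis
    by (simp add: coxeter_matrix_def simple_coord_eq K0_coord_coxeter)
qed

end
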